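(* Let $P \in \mathcal{P}^d(1)$ with $\operatorname{int}(P) \cap \mathbb{Z}^d = \{0\}$. Then $\operatorname{ca}(P, 0) \le s_{d+1} - 2$, with equality if and only if $P$ is unimodularly equivalent to $T^d_{1,d+1} = \operatorname{conv}(\{0, s_1e_1, \ldots, s_de_d\})$.
   Context: The Sylvester sequence: $s_1 = 2$, $s_i = \prod_{j=1}^{i-1} s_j + 1$ for $i\ge2$. $\mathcal{P}^d(1)$: $d$-dimensional polytopes in $\mathbb{R}^d$ with vertices in $\mathbb{Z}^d$ and exactly one integral point in the interior. For a $d$-dimensional convex body $K$ and $x\in\operatorname{int}K$, the coefficient of asymmetry is $\operatorname{ca}(K,x) := \max\{ \|a-x\|/\|b-x\| : a,b \in \partial K,\ x \in [a,b]\}$. Unimodular equivalence: existence of an affine bijection of $\mathbb{R}^d$ preserving $\mathbb{Z}^d$ mapping one onto the other. *)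

theory Defs
  imports "HOL-Analysis.Analysis"
begin

text \<open>Sylvester sequence: s 1 = 2, s i = (prod of s j for 1 <= j < i) + 1.
  The same equation gives s 1 = 2 (empty product); the value at 0 is irrelevant.\<close>
function sylvester :: "nat \<Rightarrow> nat" where
  "sylvester n = (\<Prod>j\<in>{1..<n}. sylvester j) + 1"
  by auto
termination by (relation "Wellfounded.measure id") auto

definition int_points :: "(real^'n) set" where
  "int_points = {x. \<forall>i. x $ i \<in> \<int>}"

definition lattice_polytope :: "(real^'n) set \<Rightarrow> bool" where
  "lattice_polytope P \<longleftrightarrow> (\<exists>S. finite S \<and> S \<subseteq> int_points \<and> P = convex hull S)"

definition coeff_asym :: "(real^'n) set \<Rightarrow> real^'n \<Rightarrow> real" where
  "coeff_asym K x = Sup {norm (a - x) / norm (b - x) | a b.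
      a \<in> frontier K \<and> b \<in> frontier K \<and> x \<in> closed_segment a b}"

definition unimod_equiv :: "(real^'n) set \<Rightarrow> (real^'n) set \<Rightarrow> bool" where
  "unimod_equiv P Q \<longleftrightarrow> (\<exists>f. bij f \<and> (\<exists>l c. linear l \<and> f = (\<lambda>x. l x + c))
      \<and> f ` int_points = int_points \<and> f ` P = Q)"

text \<open>T^d_{1,d+1} = conv{0, s_1 e_1, ..., s_d e_d}, where the coordinate index type 'n
  is enumerated as 1..d by a bijection idx.\<close>
definition T_simplex :: "('n \<Rightarrow> nat) \<Rightarrow> (real^'n) set" where
  "T_simplex idx = convex hull (insert 0 {real (sylvester (idx i)) *\<^sub>R axis i 1 | i. True})"

end

theory Submission
  imports Defs
begin

text \<open>
  Choose a vertex \<open>v\<close> whose ray through the origin leaves \<open>P\<close> at \<open>b = -t v\<close> with \<open>t\<close> minimal. By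
  Caratheodory, \<open>b\<close> lies in the relative interior of a simplex spanned by vertices in a face of
  \<open>P\<close>, so \<open>0\<close> has positive barycentric coordinates \<open>\<beta>\<close> in a lattice simplex with apex \<open>v\<close>, and
  \<open>\<beta> v = t / (1 + t)\<close>. Since \<open>0\<close> is the only lattice point in the relative interior of that
  simplex, a pigeonhole argument in the spirit of Minkowski's theorem yields the product-sum
  inequalities \<open>\<Prod>\<^sub>J \<beta> \<le> 1 - \<Sum>\<^sub>J \<beta>\<close> for all proper sets \<open>J\<close> of vertices. These force \<open>\<beta> v\<close> to
  be at least \<open>1 / (s\<^bsub>d+1\<^esub> - 1)\<close>, with equality only if the other coordinates are the
  \<open>1 / s\<^sub>i\<close>. In the equality case coprimality of the Sylvester numbers and the uniqueness of
  the interior lattice point identify the lattice, and every facet of the simplex through \<open>v\<close>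
  has a lattice point in its relative interior, so that \<open>P\<close> cannot be larger than the simplex.
\<close>

section \<open>Sylvester numbers and product-sum inequalities\<close>

declare sylvester.simps [simp del]

text \<open>Zero-based form: with s_{i+1} written as \<open>sylvester (Suc i)\<close>, later sums
  and products run over \<open>{..<n}\<close> and never meet the value at 0.\<close>

lemma sylvester_Suc: "sylvester (Suc n) = (\<Prod>i<n. sylvester (Suc i)) + 1"
proof -
  have "(\<Prod>j\<in>{1..<Suc n}. sylvester j) = (\<Prod>i<n. sylvester (Suc i))"
    by (rule prod.reindex_bij_witness[of _ Suc "\<lambda>j. j - 1"]) auto
  then show ?thesis
    by (simp add: sylvester.simps[of "Suc n"])
qed

lemma sylvester_Suc_ge_2: "2 \<le> sylvester (Suc n)"
proof -
  have "0 < sylvester k" for k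
    by (simp add: sylvester.simps[of k])
  then have "0 < (\<Prod>i<n. sylvester (Suc i))"
    by (intro prod_pos) auto
  then show ?thesis
    unfolding sylvester_Suc[of n] by linarith
qed

lemma sylvester_Suc_pos: "0 < sylvester (Suc n)"
  using sylvester_Suc_ge_2[of n] by linarith

lemma prod_inverse_sylvester:
  "(\<Prod>i<n. 1 / real (sylvester (Suc i))) = 1 / (real (sylvester (Suc n)) - 1)"
  by (simp add: sylvester_Suc[of n] prod_dividef)

text \<open>The induction telescopes through s_{n+2} - 1 = (s_{n+1} - 1) s_{n+1}. With
  \<open>prod_inverse_sylvester\<close> it shows that the reciprocals turn the product-sum
  inequality of every prefix into an equality.\<close>

lemma sum_inverse_sylvester:
  "(\<Sum>i<n. 1 / real (sylvester (Suc i))) = 1 - 1 / (real (sylvester (Suc n)) - 1)"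
proof (induction n)
  case 0
  then show ?case by (simp add: sylvester_Suc[of 0])
next
  case (Suc n)
  define s where "s = real (sylvester (Suc n))"
  have s: "2 \<le> s"
    using sylvester_Suc_ge_2[of n] by (simp add: s_def)
  have "sylvester (Suc (Suc n)) - 1 = (sylvester (Suc n) - 1) * sylvester (Suc n)"
    by (simp add: sylvester_Suc[of "Suc n"] sylvester_Suc[of n])
  then have "real (sylvester (Suc (Suc n)) - 1) = real (sylvester (Suc n) - 1) * s"
    by (simp only: s_def of_nat_mult)
  then have eq: "real (sylvester (Suc (Suc n))) - 1 = (s - 1) * s"
    using sylvester_Suc_ge_2[of n] sylvester_Suc_ge_2[of "Suc n"] by (simp add: s_def of_nat_diff)
  have "1 - 1 / (s - 1) + 1 / s = 1 - 1 / ((s - 1) * s)"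
    using s by (simp add: field_simps)
  then show ?case
    using Suc by (simp add: eq s_def)
qed

lemma sylvester_Suc_strict_mono: "m < n \<Longrightarrow> sylvester (Suc m) < sylvester (Suc n)"
proof (induction n)
  case (Suc n)
  have "sylvester (Suc (Suc n)) = (sylvester (Suc n) - 1) * sylvester (Suc n) + 1"
    by (simp add: sylvester_Suc[of "Suc n"] sylvester_Suc[of n])
  moreover have "1 * sylvester (Suc n) \<le> (sylvester (Suc n) - 1) * sylvester (Suc n)"
    using sylvester_Suc_ge_2[of n] by (intro mult_right_mono) auto
  ultimately have "sylvester (Suc n) < sylvester (Suc (Suc n))"
    by linarith
  then show ?case
    using Suc by (auto simp: less_Suc_eq)
qed simp

lemma coprime_sylvester:
  assumes "m \<noteq> n"
  shows "coprime (sylvester (Suc m)) (sylvester (Suc n))"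
proof -
  have less: "coprime (sylvester (Suc i)) (sylvester (Suc j))" if "i < j" for i j
  proof -
    have "sylvester (Suc i) dvd (\<Prod>i<j. sylvester (Suc i))"
      using that by (intro dvd_prodI) auto
    then show ?thesis
      unfolding sylvester_Suc[of j]
      by (metis coprime_add_one_right coprime_divisors dvd_refl)
  qed
  show ?thesis
    using assms less[of m n] less[of n m] by (metis coprime_commute linorder_neqE_nat)
qed

text \<open>Abel summation as an induction: replacing \<open>w m\<close> by \<open>w (Suc m)\<close>
  enlarges a product whose other factor, a shorter partial sum, is nonnegative. The full sum may
  have any sign; in the application it is at most 0.\<close>

lemma sum_mult_le_of_partial_sums_nonneg:
  fixes c w :: "nat \<Rightarrow> real"
  assumes "\<And>j. j \<le> m \<Longrightarrow> 0 \<le> (\<Sum>i<j. c i)" "\<And>i. i < m \<Longrightarrow> w i \<le> w (Suc i)"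
  shows "(\<Sum>i<Suc m. c i * w i) \<le> (\<Sum>i<Suc m. c i) * w m"
  using assms
proof (induction m)
  case (Suc m)
  have "(\<Sum>i<Suc m. c i * w i) \<le> (\<Sum>i<Suc m. c i) * w m"
    using Suc by simp
  also have "\<dots> \<le> (\<Sum>i<Suc m. c i) * w (Suc m)"
    using Suc.prems(1)[of "Suc m"] Suc.prems(2)[of m] by (intro mult_left_mono) auto
  finally show ?case
    by (simp add: algebra_simps)
qed simp

text \<open>Among decreasing sequences satisfying the product-sum inequalities the reciprocals of the
  Sylvester numbers maximise every partial sum. The product is compared through \<open>ln u \<le> u - 1\<close>,
  after Abel summation.\<close>

lemma sylvester_sum_maximal:
  fixes x :: "nat \<Rightarrow> real"
  assumes pos: "\<And>i. i < m \<Longrightarrow> 0 < x i"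
    and dec: "\<And>i. Suc i < m \<Longrightarrow> x (Suc i) \<le> x i"
    and prod: "\<And>j. j \<le> m \<Longrightarrow> (\<Prod>i<j. x i) \<le> 1 - (\<Sum>i<j. x i)"
    and sum: "(\<Sum>i<m. 1 / real (sylvester (Suc i))) \<le> (\<Sum>i<m. x i)"
    and "i < m"
  shows "x i = 1 / real (sylvester (Suc i))"
  using assms
proof (induction m arbitrary: i rule: less_induct)
  case (less m)
  define a where "a i = 1 / real (sylvester (Suc i))" for i
  have apos: "0 < a i" for i
    using sylvester_Suc_pos by (simp add: a_def)
  obtain l where l: "m = Suc l"
    using less.prems(5) by (cases m) auto
  \<comment> \<open>A shorter prefix of \<open>x\<close> with a larger sum than that of
    \<open>a\<close> would, by the induction hypothesis, coincide with it.\<close>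
  have partial: "0 \<le> (\<Sum>i<j. a i - x i)" if "j \<le> l" for j
  proof (rule ccontr)
    assume "\<not> ?thesis"
    then have gt: "(\<Sum>i<j. a i) < (\<Sum>i<j. x i)"
      by (simp add: sum_subtractf)
    have "x i = a i" if "i < j" for i
      unfolding a_def
      by (rule less.IH[of j]) (use \<open>j \<le> l\<close> l that gt less.prems in \<open>auto simp: a_def\<close>)
    then show False
      using gt by simp
  qed
  have le0: "(\<Sum>i<m. a i - x i) \<le> 0"
    using less.prems(4) by (simp add: sum_subtractf a_def)
  \<comment> \<open>The weights \<open>1 / x i\<close> increase because \<open>x\<close>
    decreases.\<close>
  have "(\<Sum>i<m. (a i - x i) * (1 / x i)) \<le> (\<Sum>i<m. a i - x i) * (1 / x l)"
    unfolding l
    by (rule sum_mult_le_of_partial_sums_nonneg)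
      (use partial less.prems(1,2) l in \<open>auto intro!: divide_left_mono\<close>)
  also have "\<dots> \<le> 0"
    using le0 less.prems(1)[of l] l by (intro mult_nonpos_nonneg) auto
  also have "(\<Sum>i<m. (a i - x i) * (1 / x i)) = (\<Sum>i<m. a i / x i - 1)"
    using less.prems(1) by (intro sum.cong) (force simp: diff_divide_distrib)+
  finally have D: "(\<Sum>i<m. a i / x i - 1) \<le> 0" .
  have "(\<Prod>i<m. x i) \<le> 1 - (\<Sum>i<m. x i)"
    using less.prems(3) by simp
  also have "\<dots> \<le> 1 - (\<Sum>i<m. a i)"
    using less.prems(4) by (simp add: a_def)
  also have "\<dots> = (\<Prod>i<m. a i)"
    unfolding a_def sum_inverse_sylvester prod_inverse_sylvester by simp
  finally have le: "(\<Prod>i<m. x i) \<le> (\<Prod>i<m. a i)" .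
  have ne: "a i \<noteq> 0" "x i \<noteq> 0" if "i < m" for i
    using apos less.prems(1)[OF that] by (metis less_irrefl)+
  from le have "ln (\<Prod>i<m. x i) \<le> ln (\<Prod>i<m. a i)"
    using less.prems(1) apos by (intro ln_mono prod_pos) auto
  moreover have "ln (\<Prod>i<m. x i) = (\<Sum>i<m. ln (x i))"
    by (rule ln_prod) (use ne in auto)
  moreover have "ln (\<Prod>i<m. a i) = (\<Sum>i<m. ln (a i))"
    by (rule ln_prod) (use ne in auto)
  ultimately have "0 \<le> (\<Sum>i<m. ln (a i) - ln (x i))"
    by (simp add: sum_subtractf)
  also have "\<dots> = (\<Sum>i<m. ln (a i / x i))"
    using ne by (intro sum.cong) (auto simp: ln_div)
  \<comment> \<open>With \<open>u = a i / x i\<close>, the nonnegative terms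
    \<open>u - 1 - ln u\<close> have a sum of at most 0, so each vanishes and each \<open>u\<close>
    is 1.\<close>
  finally have "(\<Sum>i<m. (a i / x i - 1) - ln (a i / x i)) \<le> 0"
    using D by (simp add: sum_subtractf)
  moreover have nn: "0 \<le> (a i / x i - 1) - ln (a i / x i)" if "i < m" for i
    using ln_le_minus_one[of "a i / x i"] less.prems(1)[OF that] apos by simp
  ultimately have "(\<Sum>i<m. (a i / x i - 1) - ln (a i / x i)) = 0"
    by (intro antisym sum_nonneg) auto
  then have "(a i / x i - 1) - ln (a i / x i) = 0"
    using sum_nonneg_eq_0_iff[of "{..<m}" "\<lambda>i. (a i / x i - 1) - ln (a i / x i)"] nn less.prems(5)
    by auto
  then have "a i / x i = 1"
    using ln_eq_minus_one[of "a i / x i"] less.prems(1)[OF less.prems(5)] apos[of i] by simp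
  then show ?case
    using less.prems(1)[OF less.prems(5)] by (simp add: a_def field_simps)
qed

lemma ex_decreasing_enumeration:
  fixes f :: "'a \<Rightarrow> 'b::linorder"
  assumes "finite A"
  shows "\<exists>e. bij_betw e {..<card A} A \<and> (\<forall>i. Suc i < card A \<longrightarrow> f (e (Suc i)) \<le> f (e i))"
proof -
  obtain ys where ys: "set ys = A" "distinct ys"
    using finite_distinct_list[OF assms] by blast
  define xs where "xs = rev (sort_key f ys)"
  have xs: "set xs = A" "distinct xs" "length xs = card A"
    using ys distinct_card[of ys] by (simp_all add: xs_def)
  have "sorted (rev (map f xs))"
    by (simp add: xs_def rev_map)
  then have "f (xs ! Suc i) \<le> f (xs ! i)" if "Suc i < card A" for i
    using that xs(3) sorted_rev_nth_mono[of "map f xs" i "Suc i"] by simp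
  moreover have "bij_betw ((!) xs) {..<card A} A"
    using bij_betw_nth[OF xs(2)] xs by auto
  ultimately show ?thesis
    by blast
qed

text \<open>Once \<open>\<beta>\<close> is sorted decreasingly, \<open>sylvester_sum_maximal\<close>
  shows that a residual at most the Sylvester value forces the reciprocals, whose residual is
  exactly that value; so it is never smaller. In use, \<open>W\<close> holds the vertices other than
  \<open>v\<close> and the residual is \<open>\<beta> v\<close>.\<close>

lemma product_sum_residual_ge:
  fixes \<beta> :: "'a \<Rightarrow> real"
  assumes "finite W" and pos: "\<And>w. w \<in> W \<Longrightarrow> 0 < \<beta> w"
    and prod: "\<And>J. J \<subseteq> W \<Longrightarrow> prod \<beta> J \<le> 1 - sum \<beta> J"
  shows "1 / (real (sylvester (Suc (card W))) - 1) \<le> 1 - sum \<beta> W"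
    and "1 - sum \<beta> W = 1 / (real (sylvester (Suc (card W))) - 1) \<Longrightarrow>
      \<exists>e. bij_betw e {..<card W} W \<and> (\<forall>i<card W. \<beta> (e i) = 1 / real (sylvester (Suc i)))"
proof -
  obtain e where e: "bij_betw e {..<card W} W"
    and dec: "\<And>i. Suc i < card W \<Longrightarrow> \<beta> (e (Suc i)) \<le> \<beta> (e i)"
    using ex_decreasing_enumeration[OF \<open>finite W\<close>, of \<beta>] by blast
  have inj: "inj_on e {..<card W}" and img: "e ` {..<card W} = W"
    using e by (auto simp: bij_betw_def)
  have sumW: "sum \<beta> W = (\<Sum>i<card W. \<beta> (e i))"
    using inj img by (metis sum.reindex_cong)
  have "(\<Prod>i<j. \<beta> (e i)) \<le> 1 - (\<Sum>i<j. \<beta> (e i))" if "j \<le> card W" for j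
  proof -
    have "inj_on e {..<j}" "e ` {..<j} \<subseteq> W"
      using that inj img by (auto simp: inj_on_def)
    then show ?thesis
      using prod[of "e ` {..<j}"] by (simp add: prod.reindex sum.reindex)
  qed
  note max = sylvester_sum_maximal[of "card W" "\<lambda>i. \<beta> (e i)", OF _ dec this]
  have eq: "\<forall>i<card W. \<beta> (e i) = 1 / real (sylvester (Suc i))"
    if "1 - sum \<beta> W \<le> 1 / (real (sylvester (Suc (card W))) - 1)"
    using that pos img unfolding sumW
    by (intro allI impI max) (auto simp: sum_inverse_sylvester)
  show "1 / (real (sylvester (Suc (card W))) - 1) \<le> 1 - sum \<beta> W"
  proof (rule ccontr)
    assume less: "\<not> ?thesis"
    then have "sum \<beta> W = (\<Sum>i<card W. 1 / real (sylvester (Suc i)))"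
      using eq by (simp add: sumW)
    then show False
      using less by (simp add: sum_inverse_sylvester)
  qed
  show "\<exists>e. bij_betw e {..<card W} W \<and> (\<forall>i<card W. \<beta> (e i) = 1 / real (sylvester (Suc i)))"
    if "1 - sum \<beta> W = 1 / (real (sylvester (Suc (card W))) - 1)"
    using eq that e by auto
qed

section \<open>Barycentric coordinates of the only interior lattice point\<close>

text \<open>An integer form of Minkowski's theorem for the linear forms
  \<open>z \<mapsto> (\<Sum>z) p\<^sub>i - N z\<^sub>i\<close>: their values form a sublattice of index \<open>N ^ (card J - 1) * q\<close>, and
  \<open>key\<close> below separates its cosets.\<close>

lemma pigeonhole_linear_forms:
  fixes p :: "'a \<Rightarrow> int" and N q :: int
  assumes "finite J" "J \<noteq> {}" and p: "\<And>i. i \<in> J \<Longrightarrow> 0 < p i"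
    and "0 < N" "0 < q" and N: "sum p J + q = N"
    and big: "N ^ (card J - 1) * q < prod p J"
  obtains z m where "0 \<le> m" "sum z J = m" "\<And>i. i \<in> J \<Longrightarrow> \<bar>m * p i - N * z i\<bar> < p i"
    "\<exists>i\<in>J. m * p i \<noteq> N * z i"
proof -
  obtain l where l: "l \<in> J"
    using \<open>J \<noteq> {}\<close> by blast
  \<comment> \<open>The congruence modulo \<open>N\<close> at \<open>l\<close> will follow from
    those on \<open>K\<close> and the total sum; hence the exponent
    \<open>card J - 1\<close>.\<close>
  define K where "K = J - {l}"
  have J: "J = insert l K" "l \<notin> K" "finite K" "card K = card J - 1"
    using l \<open>finite J\<close> by (auto simp: K_def)
  \<comment> \<open>Values \<open>m * p i - N * z i\<close> with \<open>sum z J = m\<close> add up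
    to \<open>- m * q\<close>. So \<open>mm\<close> reads \<open>m\<close> off the sum, and
    \<open>key\<close> records the remainder modulo \<open>q\<close> and the residues left after
    removing \<open>m * p i\<close>.\<close>
  define mm where "mm x = - (sum x J div q)" for x :: "'a \<Rightarrow> int"
  define key where "key x = (sum x J mod q, \<lambda>i\<in>K. (x i - mm x * p i) mod N)" for x
  define B where "B = (\<Pi>\<^sub>E i\<in>J. {0..<p i})"
  define C where "C = {0..<q} \<times> (\<Pi>\<^sub>E i\<in>K. {0..<N})"
  have "key ` B \<subseteq> C"
    using \<open>0 < N\<close> \<open>0 < q\<close> by (auto simp: key_def C_def)
  moreover have "finite C"
    using J by (auto simp: C_def intro!: finite_PiE)
  moreover have "card C < card B"
  proof -
    have "int (card C) = q * N ^ card K"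
      using J \<open>0 < N\<close> \<open>0 < q\<close> by (simp add: C_def card_cartesian_product card_PiE)
    moreover have "int (card B) = prod p J"
      unfolding B_def card_PiE[OF \<open>finite J\<close>] of_nat_prod
      by (rule prod.cong) (simp_all add: less_imp_le[OF p])
    ultimately show ?thesis
      using big J(4) by (simp add: mult.commute)
  qed
  ultimately have "\<not> inj_on key B"
    by (meson card_inj_on_le not_less)
  then obtain x0 y0 where xy0: "x0 \<in> B" "y0 \<in> B" "x0 \<noteq> y0" "key x0 = key y0"
    by (auto simp: inj_on_def)
  \<comment> \<open>The colliding points are ordered so that \<open>m\<close> below is
    nonnegative.\<close>
  then obtain x y where xy: "x \<in> B" "y \<in> B" "x \<noteq> y" "key x = key y" "mm y \<le> mm x"
    by (metis linear)
  define m where "m = mm x - mm y"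
  define d where "d i = x i - y i" for i
  have "sum x J mod q = sum y J mod q"
    using xy(4) by (simp add: key_def)
  then have "sum x J - sum y J = q * (sum x J div q) - q * (sum y J div q)"
    using mult_div_mod_eq[of q "sum x J"] mult_div_mod_eq[of q "sum y J"] by linarith
  then have sumd: "sum d J = - m * q"
    unfolding d_def sum_subtractf m_def mm_def by (simp add: algebra_simps)
  have dK: "N dvd m * p i - d i" if "i \<in> K" for i
  proof -
    have "(\<lambda>i\<in>K. (x i - mm x * p i) mod N) i = (\<lambda>i\<in>K. (y i - mm y * p i) mod N) i"
      using xy(4) by (simp add: key_def)
    then have "N dvd (x i - mm x * p i) - (y i - mm y * p i)"
      using that by (simp add: mod_eq_dvd_iff)
    then have "N dvd - ((x i - mm x * p i) - (y i - mm y * p i))"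
      by (simp only: dvd_minus_iff)
    then show ?thesis
      by (simp add: m_def d_def algebra_simps)
  qed
  have sum_all: "(\<Sum>i\<in>J. m * p i - d i) = m * N"
    by (simp add: sum_subtractf sumd algebra_simps sum_distrib_left flip: N)
  then have "(m * p l - d l) = m * N - (\<Sum>i\<in>K. m * p i - d i)"
    using J by simp
  moreover have "N dvd m * N - (\<Sum>i\<in>K. m * p i - d i)"
    by (rule dvd_diff[OF dvd_triv_right dvd_sum[OF dK]])
  ultimately have "N dvd m * p l - d l"
    by simp
  with dK have dJ: "N dvd m * p i - d i" if "i \<in> J" for i
    using that J by auto
  define z where "z i = (m * p i - d i) div N" for i
  have Nz: "N * z i = m * p i - d i" if "i \<in> J" for i
    using dJ[OF that] by (simp add: z_def)
  have "N * sum z J = (\<Sum>i\<in>J. m * p i - d i)"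
    unfolding sum_distrib_left by (rule sum.cong) (auto simp: Nz)
  then have "sum z J = m"
    using sum_all \<open>0 < N\<close> by simp
  moreover have "0 \<le> m"
    using xy by (simp add: m_def)
  moreover have "\<bar>m * p i - N * z i\<bar> < p i" if "i \<in> J" for i
  proof -
    have "x i \<in> {0..<p i}" "y i \<in> {0..<p i}"
      using xy(1,2) that by (auto simp: B_def PiE_iff)
    then show ?thesis
      by (auto simp: Nz[OF that] d_def)
  qed
  moreover have "\<exists>i\<in>J. m * p i \<noteq> N * z i"
  proof -
    obtain i where "i \<in> J" "x i \<noteq> y i"
      using xy(1-3) unfolding B_def by (meson PiE_ext)
    then show ?thesis
      by (intro bexI[of _ i]) (auto simp: Nz d_def)
  qed
  ultimately show thesis
    using that by blast
qed

section \<open>Rationality of barycentric coordinates\<close>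

interpretation real_over_rat: vector_space_pair "\<lambda>q x. real_of_rat q * x" "(*) :: rat \<Rightarrow> rat \<Rightarrow> rat"
  by unfold_locales (auto simp: algebra_simps of_rat_add of_rat_mult)

text \<open>Extends 1 \<mapsto> 1 along a basis of \<real> over \<rat>. It serves to turn a real
  solution of a rational linear system into a rational one.\<close>

lemma ex_rat_linear_projection:
  obtains \<pi> :: "real \<Rightarrow> rat" where "\<pi> 1 = 1" "\<And>x y. \<pi> (x + y) = \<pi> x + \<pi> y"
    "\<And>q x. \<pi> (real_of_rat q * x) = q * \<pi> x"
proof -
  have "\<not> real_over_rat.vs1.dependent {1}"
    by (simp add: real_over_rat.vs1.dependent_single)
  then obtain \<pi> :: "real \<Rightarrow> rat" where \<pi>: "Vector_Spaces.linear (\<lambda>q x. real_of_rat q * x) (*) \<pi>"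
    and "\<pi> 1 = 1"
    using real_over_rat.linear_independent_extend[of "{1}" "\<lambda>_. 1"] by auto
  interpret Vector_Spaces.linear "\<lambda>q x. real_of_rat q * x" "(*)" \<pi>
    by (rule \<pi>)
  show thesis
    using that[of \<pi>] \<open>\<pi> 1 = 1\<close> add scale by auto
qed

lemma affine_independent_unique_coeffs:
  fixes V :: "'a::real_vector set"
  assumes "finite V" "\<not> affine_dependent V"
    and "sum \<gamma> V = sum \<beta> V" "(\<Sum>v\<in>V. \<gamma> v *\<^sub>R v) = (\<Sum>v\<in>V. \<beta> v *\<^sub>R v)" "v \<in> V"
  shows "\<gamma> v = \<beta> v"
proof (rule ccontr)
  assume "\<gamma> v \<noteq> \<beta> v"
  then have "affine_dependent V"
    unfolding affine_dependent_explicit_finite[OF \<open>finite V\<close>]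
    using assms(3-5)
    by (intro exI[of _ "\<lambda>v. \<gamma> v - \<beta> v"] conjI bexI[of _ v])
      (auto simp: sum_subtractf scaleR_left_diff_distrib)
  then show False
    using assms by simp
qed

text \<open>The barycentric coordinates solve a linear system with rational coefficients and a unique
  solution, hence are fixed by any \<open>\<rat>\<close>-linear projection of \<open>\<real>\<close> onto \<open>\<rat>\<close>.\<close>

lemma barycentric_coordinates_rational:
  fixes V :: "(real^'n) set"
  assumes "finite V" "V \<subseteq> int_points" "\<not> affine_dependent V"
    and "sum \<beta> V = 1" "(\<Sum>v\<in>V. \<beta> v *\<^sub>R v) = 0" "v \<in> V"
  shows "\<beta> v \<in> \<rat>"
proof -
  obtain \<pi> where \<pi>: "\<pi> 1 = 1" "\<And>x y. \<pi> (x + y) = \<pi> x + \<pi> y"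
    "\<And>q x. \<pi> (real_of_rat q * x) = q * \<pi> x"
    by (rule ex_rat_linear_projection) blast
  have \<pi>0: "\<pi> 0 = 0"
    using \<pi>(2)[of 0 0] by simp
  have \<pi>sum: "\<pi> (sum f V) = (\<Sum>v\<in>V. \<pi> (f v))" for f
    using \<open>finite V\<close> by (induction V rule: finite_induct) (auto simp: \<pi> \<pi>0)
  have \<pi>int: "real_of_rat (\<pi> (x * y)) = real_of_rat (\<pi> x) * y" if "y \<in> \<int>" for x y
  proof -
    obtain k where "y = of_int k"
      using \<open>y \<in> \<int>\<close> by (auto elim: Ints_cases)
    then show ?thesis
      using \<pi>(3)[of "of_int k" x] by (simp add: mult.commute of_rat_mult)
  qed
  define \<gamma> where "\<gamma> v = real_of_rat (\<pi> (\<beta> v))" for v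
  have "sum \<gamma> V = 1"
    using \<pi>sum[of \<beta>] assms(4) \<pi>(1) by (simp add: \<gamma>_def flip: of_rat_sum)
  moreover have "(\<Sum>v\<in>V. \<gamma> v *\<^sub>R v) = 0"
  proof (rule vec_eq_iff[THEN iffD2, rule_format])
    fix i
    have "(\<Sum>v\<in>V. \<gamma> v *\<^sub>R v) $ i = (\<Sum>v\<in>V. real_of_rat (\<pi> (\<beta> v * v $ i)))"
      using assms(2) by (auto simp: \<gamma>_def int_points_def \<pi>int intro!: sum.cong)
    also have "\<dots> = real_of_rat (\<pi> (\<Sum>v\<in>V. \<beta> v * v $ i))"
      by (simp add: \<pi>sum of_rat_sum)
    also have "(\<Sum>v\<in>V. \<beta> v * v $ i) = (\<Sum>v\<in>V. \<beta> v *\<^sub>R v) $ i"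
      by simp
    finally show "(\<Sum>v\<in>V. \<gamma> v *\<^sub>R v) $ i = 0 $ i"
      using assms(5) by (simp add: \<pi>0)
  qed
  ultimately have "\<gamma> v = \<beta> v"
    using affine_independent_unique_coeffs[of V \<gamma> \<beta> v] assms by simp
  then show ?thesis
    by (metis \<gamma>_def Rats_of_rat)
qed

lemma ex_common_denominator:
  fixes \<beta> :: "'a \<Rightarrow> real"
  assumes "finite V" "\<And>v. v \<in> V \<Longrightarrow> \<beta> v \<in> \<rat>"
  shows "\<exists>N::int. 0 < N \<and> (\<forall>v\<in>V. of_int N * \<beta> v \<in> \<int>)"
  using assms
proof (induction V rule: finite_induct)
  case empty
  show ?case by (intro exI[of _ 1]) auto
next
  case (insert w V)
  then obtain N :: int where N: "0 < N" "\<forall>v\<in>V. of_int N * \<beta> v \<in> \<int>"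
    by auto
  obtain a b :: int where ab: "0 < b" "\<beta> w = of_int a / of_int b"
    using insert.prems[of w] by (auto elim: Rats_cases')
  have "of_int (N * b) * \<beta> v \<in> \<int>" if "v \<in> insert w V" for v
  proof (cases "v = w")
    case True
    then have "of_int (N * b) * \<beta> v = of_int (N * a)"
      using ab by simp
    then show ?thesis by (metis Ints_of_int)
  next
    case False
    have "of_int b * (of_int N * \<beta> v) \<in> \<int>"
      by (rule Ints_mult) (use that N False in auto)
    then show ?thesis by (simp add: mult_ac)
  qed
  then show ?case
    using N ab by (intro exI[of _ "N * b"]) auto
qed

section \<open>Closure properties of the lattice and the product-sum inequality\<close>

lemma int_points_sum: "(\<And>i. i \<in> A \<Longrightarrow> f i \<in> int_points) \<Longrightarrow> sum f A \<in> int_points"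
  by (auto simp: int_points_def intro!: Ints_sum)

lemma int_points_scaleR: "c \<in> \<int> \<Longrightarrow> x \<in> int_points \<Longrightarrow> c *\<^sub>R x \<in> int_points"
  by (auto simp: int_points_def intro!: Ints_mult)

lemma int_points_add: "x \<in> int_points \<Longrightarrow> y \<in> int_points \<Longrightarrow> x + y \<in> int_points"
  by (auto simp: int_points_def)

lemma int_points_diff: "x \<in> int_points \<Longrightarrow> y \<in> int_points \<Longrightarrow> x - y \<in> int_points"
  by (auto simp: int_points_def)

lemma int_points_uminus: "x \<in> int_points \<Longrightarrow> - x \<in> int_points"
  by (auto simp: int_points_def)

text \<open>If it failed, \<open>pigeonhole_linear_forms\<close>, applied to the numerators
  \<open>p\<close> of \<open>\<beta>\<close> over a common denominator \<open>N\<close>, would yield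
  integers \<open>z\<close> on \<open>J\<close> and another positive representation
  \<open>\<gamma>\<close> of a lattice point. That point must be 0, so
  \<open>\<gamma> = \<beta>\<close> by uniqueness and \<open>m * p i = N * z i\<close> on all of
  \<open>J\<close>, which the pigeonhole excludes. Properness of \<open>J\<close> makes
  \<open>q\<close> positive.\<close>

lemma product_sum_inequality:
  fixes V :: "(real^'n) set"
  assumes "finite V" "V \<subseteq> int_points" "\<not> affine_dependent V"
    and pos: "\<And>v. v \<in> V \<Longrightarrow> 0 < \<beta> v"
    and sum1: "sum \<beta> V = 1" and sum0: "(\<Sum>v\<in>V. \<beta> v *\<^sub>R v) = 0"
    and only: "\<And>\<gamma>. (\<And>v. v \<in> V \<Longrightarrow> 0 < \<gamma> v) \<Longrightarrow> sum \<gamma> V = 1 \<Longrightarrow>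
      (\<Sum>v\<in>V. \<gamma> v *\<^sub>R v) \<in> int_points \<Longrightarrow> (\<Sum>v\<in>V. \<gamma> v *\<^sub>R v) = 0"
    and "J \<subset> V"
  shows "prod \<beta> J \<le> 1 - sum \<beta> J"
proof (cases "J = {}")
  case False
  have fJ: "finite J"
    using \<open>J \<subset> V\<close> \<open>finite V\<close> finite_subset by blast
  have sumdiff: "sum \<beta> (V - J) = 1 - sum \<beta> J"
    using \<open>J \<subset> V\<close> \<open>finite V\<close> sum1 by (simp add: sum_diff)
  show ?thesis
  proof (rule ccontr)
    assume neg: "\<not> ?thesis"
    obtain N :: int where N: "0 < N" "\<forall>v\<in>V. of_int N * \<beta> v \<in> \<int>"
      using ex_common_denominator[OF \<open>finite V\<close>] barycentric_coordinates_rational[OF assms(1-3) sum1 sum0]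
      by metis
    define p where "p v = \<lfloor>of_int N * \<beta> v\<rfloor>" for v
    have p: "of_int (p v) = of_int N * \<beta> v" if "v \<in> V" for v
      using N that by (auto simp: p_def elim: Ints_cases)
    have ppos: "0 < p v" if "v \<in> V" for v
    proof -
      have "0 < real_of_int (p v)"
        unfolding p[OF that] using N pos[OF that] by simp
      then show ?thesis by simp
    qed
    define q where "q = sum p (V - J)"
    have q: "of_int q = of_int N * (1 - sum \<beta> J)"
      by (simp add: q_def p sum_distrib_left flip: sumdiff)
    have "0 < q"
      unfolding q_def using \<open>J \<subset> V\<close> \<open>finite V\<close> by (intro sum_pos) (auto intro: ppos)
    have "real_of_int (sum p J) = of_int N * sum \<beta> J"
      using \<open>J \<subset> V\<close> by (auto simp: sum_distrib_left intro!: sum.cong p)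
    then have "real_of_int (sum p J + q) = of_int N"
      using q by (simp add: algebra_simps)
    then have sump: "sum p J + q = N"
      by linarith
    have "real_of_int (prod p J) = (\<Prod>v\<in>J. of_int N * \<beta> v)"
      using \<open>J \<subset> V\<close> by (auto intro!: prod.cong p)
    also have "\<dots> = of_int N ^ card J * prod \<beta> J"
      by (simp add: prod.distrib)
    finally have prodp: "real_of_int (prod p J) = of_int N ^ card J * prod \<beta> J" .
    have "real_of_int (N ^ (card J - 1) * q) = of_int N ^ card J * (1 - sum \<beta> J)"
      using False fJ by (simp add: q card_gt_0_iff flip: power_Suc2 mult.assoc)
    also have "\<dots> < real_of_int (prod p J)"
      unfolding prodp using neg N by simp
    finally have big: "N ^ (card J - 1) * q < prod p J"
      by linarith
    obtain z m where z: "0 \<le> m" "sum z J = m" "\<And>i. i \<in> J \<Longrightarrow> \<bar>m * p i - N * z i\<bar> < p i"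
      "\<exists>i\<in>J. m * p i \<noteq> N * z i"
      by (rule pigeonhole_linear_forms[OF fJ False _ \<open>0 < N\<close> \<open>0 < q\<close> sump big])
        (use ppos \<open>J \<subset> V\<close> in auto)
    define \<zeta> where "\<zeta> v = (if v \<in> J then real_of_int (z v) else 0)" for v
    \<comment> \<open>Adding \<open>m\<close> times \<open>\<beta>\<close> does not move the point,
      since \<open>\<beta>\<close> represents 0; subtracting the integers \<open>\<zeta>\<close>
      moves it by a lattice vector and restores the sum 1.\<close>
    define \<gamma> where "\<gamma> v = \<beta> v + (of_int m * \<beta> v - \<zeta> v)" for v
    have sum\<zeta>: "sum \<zeta> V = of_int m"
    proof -
      have "sum \<zeta> V = sum \<zeta> J"
        using \<open>finite V\<close> \<open>J \<subset> V\<close> by (intro sum.mono_neutral_right) (auto simp: \<zeta>_def)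
      also have "\<dots> = of_int (sum z J)"
        by (simp add: \<zeta>_def)
      finally show ?thesis using z by simp
    qed
    \<comment> \<open>On \<open>J\<close> the pigeonhole bound keeps the coefficient positive, off
      \<open>J\<close> it is \<open>0 \<le> m\<close>.\<close>
    have \<gamma>pos: "0 < \<gamma> v" if "v \<in> V" for v
    proof (cases "v \<in> J")
      case True
      have "real_of_int N * \<gamma> v = of_int (p v + (m * p v - N * z v))"
        using True by (simp add: \<gamma>_def \<zeta>_def p[OF that] algebra_simps)
      also have "\<dots> > 0"
        using z(3)[OF True] by linarith
      finally show ?thesis
        using N by (simp add: zero_less_mult_iff)
    next
      case False
      then show ?thesis
        using pos[OF that] z(1) by (simp add: \<gamma>_def \<zeta>_def add_pos_nonneg)
    qed
    have \<gamma>1: "sum \<gamma> V = 1"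
      by (simp add: \<gamma>_def sum.distrib sum_subtractf sum1 sum\<zeta> flip: sum_distrib_left)
    have "(\<Sum>v\<in>V. \<gamma> v *\<^sub>R v) = (\<Sum>v\<in>V. \<beta> v *\<^sub>R v) + of_int m *\<^sub>R (\<Sum>v\<in>V. \<beta> v *\<^sub>R v)
        - (\<Sum>v\<in>V. \<zeta> v *\<^sub>R v)"
      by (simp add: \<gamma>_def scaleR_left_distrib scaleR_left_diff_distrib sum.distrib sum_subtractf
          scaleR_sum_right)
    also have "\<dots> = - (\<Sum>v\<in>V. \<zeta> v *\<^sub>R v)"
      by (simp add: sum0)
    also have "\<dots> \<in> int_points"
      using assms(2) by (intro int_points_uminus int_points_sum int_points_scaleR) (auto simp: \<zeta>_def)
    finally have "(\<Sum>v\<in>V. \<gamma> v *\<^sub>R v) \<in> int_points" .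
    then have "(\<Sum>v\<in>V. \<gamma> v *\<^sub>R v) = 0"
      by (intro only \<gamma>pos \<gamma>1)
    then have eq: "\<gamma> v = \<beta> v" if "v \<in> V" for v
      using affine_independent_unique_coeffs[of V \<gamma> \<beta>] that assms(1,3) sum0 sum1 \<gamma>1 by simp
    obtain i where i: "i \<in> J" "m * p i \<noteq> N * z i"
      using z by blast
    then have "of_int m * \<beta> i = of_int (z i)"
      using eq[of i] \<open>J \<subset> V\<close> by (auto simp: \<gamma>_def \<zeta>_def)
    then have "real_of_int (m * p i) = of_int (N * z i)"
      using p[of i] i \<open>J \<subset> V\<close> by (auto simp: algebra_simps)
    then show False
      using i by linarith
  qed
qed simp

section \<open>Reduction to simplices\<close>

text \<open>Removing a small multiple \<open>\<epsilon>\<close> of \<open>\<beta>\<close> leaves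
  nonnegative coefficients, so the point is some \<open>y\<close> in \<open>P\<close> pulled towards
  the interior point 0. This transfers uniqueness of the interior lattice point of \<open>P\<close>
  to inscribed simplices, also lower-dimensional ones.\<close>

lemma positive_combination_in_interior:
  fixes P :: "'a::euclidean_space set"
  assumes "convex P" "0 \<in> interior P" "finite V" "V \<subseteq> P"
    and \<beta>: "\<And>v. v \<in> V \<Longrightarrow> 0 < \<beta> v" "sum \<beta> V = 1" "(\<Sum>v\<in>V. \<beta> v *\<^sub>R v) = 0"
    and \<gamma>: "\<And>v. v \<in> V \<Longrightarrow> 0 < \<gamma> v" "sum \<gamma> V = 1"
  shows "(\<Sum>v\<in>V. \<gamma> v *\<^sub>R v) \<in> interior P"
proof -
  \<comment> \<open>The cap 1/2 keeps \<open>1 - \<epsilon>\<close> positive.\<close>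
  define \<epsilon> where "\<epsilon> = Min (insert (1/2) ((\<lambda>v. \<gamma> v / \<beta> v) ` V))"
  have \<epsilon>: "0 < \<epsilon>" "\<epsilon> \<le> 1/2"
    using \<open>finite V\<close> \<beta>(1) \<gamma>(1) Min_le[of "insert (1/2) ((\<lambda>v. \<gamma> v / \<beta> v) ` V)" "1/2"]
    by (auto simp: \<epsilon>_def)
  have le: "0 \<le> \<gamma> v - \<epsilon> * \<beta> v" if "v \<in> V" for v
  proof -
    have "\<epsilon> \<le> \<gamma> v / \<beta> v"
      using \<open>finite V\<close> that by (auto simp: \<epsilon>_def intro!: Min_le)
    then show ?thesis
      using \<beta>(1)[OF that] by (simp add: field_simps)
  qed
  define y where "y = (\<Sum>v\<in>V. ((\<gamma> v - \<epsilon> * \<beta> v) / (1 - \<epsilon>)) *\<^sub>R v)"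
  have "(\<Sum>v\<in>V. (\<gamma> v - \<epsilon> * \<beta> v) / (1 - \<epsilon>)) = 1"
    using \<epsilon> \<beta>(2) \<gamma>(2) by (simp add: sum_subtractf flip: sum_divide_distrib sum_distrib_left)
  then have "y \<in> P"
    unfolding y_def using assms(1,3,4) \<epsilon> le by (intro convex_sum) auto
  have "(1 - \<epsilon>) *\<^sub>R y = (\<Sum>v\<in>V. (\<gamma> v - \<epsilon> * \<beta> v) *\<^sub>R v)"
    using \<epsilon> by (simp add: y_def scaleR_sum_right)
  also have "\<dots> = (\<Sum>v\<in>V. \<gamma> v *\<^sub>R v) - \<epsilon> *\<^sub>R (\<Sum>v\<in>V. \<beta> v *\<^sub>R v)"
    by (simp add: scaleR_left_diff_distrib sum_subtractf scaleR_sum_right)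
  finally have "(\<Sum>v\<in>V. \<gamma> v *\<^sub>R v) = y - \<epsilon> *\<^sub>R (y - 0)"
    using \<beta>(3) by (simp add: scaleR_left_diff_distrib)
  also have "\<dots> \<in> interior P"
    using \<open>y \<in> P\<close> \<epsilon> assms(1,2) closure_subset
    by (intro mem_interior_closure_convex_shrink) auto
  finally show ?thesis .
qed

text \<open>Take a subset of least cardinality whose hull contains \<open>b\<close>: Caratheodory
  makes it affinely independent, and a zero coefficient would allow dropping a point.\<close>

lemma ex_minimal_simplex_coeffs:
  fixes b :: "'a::euclidean_space"
  assumes "finite F" "b \<in> convex hull F"
  obtains W \<alpha> where "W \<subseteq> F" "\<not> affine_dependent W" "\<And>w. w \<in> W \<Longrightarrow> 0 < \<alpha> w" "sum \<alpha> W = 1"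
    "(\<Sum>w\<in>W. \<alpha> w *\<^sub>R w) = b"
proof -
  define Q where "Q W \<longleftrightarrow> W \<subseteq> F \<and> b \<in> convex hull W" for W
  obtain W where W: "Q W" and min: "\<And>W'. Q W' \<Longrightarrow> card W \<le> card W'"
    using arg_min_natI[of Q F card] arg_min_nat_le[of Q _ card] assms(2) unfolding Q_def
    by (metis (no_types, lifting) order_refl)
  have fin: "finite W"
    using W \<open>finite F\<close> finite_subset by (auto simp: Q_def)
  have minW: "W' = W" if "W' \<subseteq> W" "b \<in> convex hull W'" for W'
    using that min[of W'] W fin by (intro card_seteq) (auto simp: Q_def)
  obtain W' where W': "W' \<subseteq> W" "int (card W') \<le> aff_dim W + 1" "b \<in> convex hull W'"
    using W unfolding Q_def caratheodory_aff_dim[of W] by blast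
  then have "int (card W) \<le> aff_dim W + 1"
    using minW by blast
  then have indep: "\<not> affine_dependent W"
    using fin aff_dim_le_card[OF fin] by (simp add: affine_independent_iff_card)
  obtain \<alpha> where \<alpha>: "\<forall>w\<in>W. 0 \<le> \<alpha> w" "sum \<alpha> W = 1" "(\<Sum>w\<in>W. \<alpha> w *\<^sub>R w) = b"
    using W fin by (auto simp: Q_def convex_hull_finite)
  have "\<alpha> w \<noteq> 0" if w: "w \<in> W" for w
  proof
    assume "\<alpha> w = 0"
    then have "sum \<alpha> (W - {w}) = 1" "(\<Sum>w\<in>W - {w}. \<alpha> w *\<^sub>R w) = b"
      using \<alpha> fin w by (simp_all add: sum_diff1)
    then have "b \<in> convex hull (W - {w})"
      using \<alpha>(1) fin by (auto simp: convex_hull_finite)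
    then show False
      using minW[of "W - {w}"] w by blast
  qed
  then show thesis
    using that[of W \<alpha>] W \<alpha> indep by (auto simp: Q_def less_le)
qed

text \<open>The frontier point opposite to \<open>v\<close> lies on a supporting hyperplane, and a minimal simplex
  in that face together with \<open>v\<close> contains the origin in its relative interior.\<close>

lemma ex_simplex_around_origin:
  fixes S :: "'a::euclidean_space set"
  assumes "finite S" "0 \<in> interior (convex hull S)" "v \<in> S" "0 < t"
    "- (t *\<^sub>R v) \<in> frontier (convex hull S)"
  obtains W \<beta> h c where "W \<subseteq> S" "v \<notin> W" "\<not> affine_dependent (insert v W)"
    "\<And>p. p \<in> convex hull S \<Longrightarrow> h \<bullet> p \<le> c" "\<And>w. w \<in> W \<Longrightarrow> h \<bullet> w = c" "h \<bullet> v < c"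
    "\<And>u. u \<in> insert v W \<Longrightarrow> 0 < \<beta> u" "sum \<beta> (insert v W) = 1"
    "(\<Sum>u\<in>insert v W. \<beta> u *\<^sub>R u) = 0" "\<beta> v = t / (1 + t)"
proof -
  define P where "P = convex hull S"
  define b where "b = - (t *\<^sub>R v)"
  have P: "convex P" "compact P" "closed P"
    using \<open>finite S\<close> by (auto simp: P_def finite_imp_compact compact_convex_hull compact_imp_closed)
  have b: "b \<in> P" "b \<notin> interior P"
    using assms(5) P by (auto simp: b_def P_def frontier_def)
  have rel: "rel_interior P = interior P"
    using assms(2) by (intro rel_interior_nonempty_interior) (auto simp: P_def)
  obtain h' where h': "\<And>y. y \<in> closure P \<Longrightarrow> h' \<bullet> b \<le> h' \<bullet> y"
    "\<And>y. y \<in> rel_interior P \<Longrightarrow> h' \<bullet> b < h' \<bullet> y"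
    using supporting_hyperplane_relative_frontier[of P b] P b rel
    by (metis closure_closed)
  define h where "h = - h'"
  define c where "c = h \<bullet> b"
  have le: "h \<bullet> p \<le> c" if "p \<in> P" for p
    using h'(1)[of p] that P by (simp add: h_def c_def)
  have "0 < c"
    using h'(2)[of 0] assms(2) rel by (simp add: h_def c_def P_def)
  \<comment> \<open>As \<open>b\<close> is a negative multiple of \<open>v\<close> and
    \<open>h \<bullet> b = c > 0\<close>, the point \<open>v\<close> lies off the supporting
    hyperplane, which makes it affinely independent of \<open>W\<close>.\<close>
  then have hv: "h \<bullet> v < 0"
    using \<open>0 < t\<close> by (simp add: c_def b_def mult_less_0_iff)
  define F where "F = P \<inter> {x. h \<bullet> x = c}"
  have "F face_of P"
    unfolding F_def using P le by (intro face_of_Int_supporting_hyperplane_le) auto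
  then obtain S' where S': "S' \<subseteq> S" "F = convex hull S'"
    unfolding P_def using \<open>finite S\<close> by (meson face_of_convex_hull_subset finite_imp_compact)
  have "b \<in> convex hull S'"
    using b S'(2) by (auto simp: F_def c_def)
  then obtain W \<alpha> where W: "W \<subseteq> S'" "\<not> affine_dependent W" "\<And>w. w \<in> W \<Longrightarrow> 0 < \<alpha> w"
    "sum \<alpha> W = 1" "(\<Sum>w\<in>W. \<alpha> w *\<^sub>R w) = b"
    using ex_minimal_simplex_coeffs[of S' b] S' \<open>finite S\<close> by (metis finite_subset)
  have fin: "finite W"
    using W(2) aff_independent_finite by blast
  have hW: "h \<bullet> w = c" if "w \<in> W" for w
  proof -
    have "w \<in> F"
      using that W(1) S'(2) by (auto intro: hull_inc)
    then show ?thesis by (simp add: F_def)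
  qed
  have "affine hull W \<subseteq> {x. h \<bullet> x = c}"
    using hW by (intro hull_minimal affine_hyperplane) auto
  then have vW: "v \<notin> affine hull W"
    using hv \<open>0 < c\<close> by auto
  then have "v \<notin> W"
    by (meson hull_inc)
  \<comment> \<open>The relation \<open>t *\<^sub>R v + b = 0\<close>, with \<open>b\<close>
    expanded over \<open>W\<close>, has total weight \<open>1 + t\<close>.\<close>
  define \<beta> where "\<beta> u = (if u = v then t else \<alpha> u) / (1 + t)" for u
  have \<beta>W: "\<beta> w = \<alpha> w / (1 + t)" if "w \<in> W" for w
    using that \<open>v \<notin> W\<close> by (auto simp: \<beta>_def)
  have \<beta>v: "\<beta> v = t / (1 + t)"
    by (simp add: \<beta>_def)
  have "sum \<beta> (insert v W) = t / (1 + t) + (\<Sum>w\<in>W. \<alpha> w / (1 + t))"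
    using fin \<open>v \<notin> W\<close> \<beta>W \<beta>v by (simp cong: sum.cong)
  also have "\<dots> = 1"
    using W(4) \<open>0 < t\<close> by (simp add: field_simps flip: sum_divide_distrib)
  finally have sum1: "sum \<beta> (insert v W) = 1" .
  have "(\<Sum>u\<in>insert v W. \<beta> u *\<^sub>R u) = (t / (1 + t)) *\<^sub>R v + (\<Sum>w\<in>W. (1 / (1 + t)) *\<^sub>R (\<alpha> w *\<^sub>R w))"
    using fin \<open>v \<notin> W\<close> \<beta>W \<beta>v by (simp cong: sum.cong)
  also have "\<dots> = (1 / (1 + t)) *\<^sub>R (t *\<^sub>R v + b)"
    unfolding scaleR_sum_right[symmetric] W(5) by (simp add: scaleR_right_distrib)
  finally have sum0: "(\<Sum>u\<in>insert v W. \<beta> u *\<^sub>R u) = 0"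
    by (simp add: b_def)
  show thesis
  proof (rule that[of W h c \<beta>])
    show "W \<subseteq> S" using W(1) S'(1) by blast
    show "\<not> affine_dependent (insert v W)"
      using W(2) vW by (rule affine_independent_insert)
    show "\<And>p. p \<in> convex hull S \<Longrightarrow> h \<bullet> p \<le> c"
      using le by (simp add: P_def)
    show "h \<bullet> v < c"
      using hv \<open>0 < c\<close> by linarith
    show "0 < \<beta> u" if "u \<in> insert v W" for u
      using that W(3) \<open>0 < t\<close> by (auto simp: \<beta>_def)
  qed (use \<open>v \<notin> W\<close> hW sum1 sum0 \<beta>v in auto)
qed

section \<open>Facet inequalities of \<open>T_simplex\<close>\<close>

lemma T_simplex_eq:
  fixes idx :: "'n::finite \<Rightarrow> nat"
  assumes idx: "\<And>i. 0 < idx i"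
  shows "T_simplex idx = {x. (\<forall>i. 0 \<le> x $ i) \<and> (\<Sum>i\<in>UNIV. x $ i / real (sylvester (idx i))) \<le> 1}"
proof -
  define s where "s i = real (sylvester (idx i))" for i
  have s: "0 < s i" for i
    using sylvester_Suc_pos[of "idx i - 1"] idx[of i] by (simp add: s_def)
  define E where "E = insert 0 {s i *\<^sub>R axis i (1::real) | i. True}"
  define C where "C = {x::real^'n. (\<forall>i. 0 \<le> x $ i) \<and> (\<Sum>i\<in>UNIV. x $ i / s i) \<le> 1}"
  have "convex C"
  proof (rule convexI)
    fix x y :: "real^'n" and u w :: real
    assume *: "x \<in> C" "y \<in> C" "0 \<le> u" "0 \<le> w" "u + w = 1"
    have "(\<Sum>i\<in>UNIV. (u *\<^sub>R x + w *\<^sub>R y) $ i / s i)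
        = u * (\<Sum>i\<in>UNIV. x $ i / s i) + w * (\<Sum>i\<in>UNIV. y $ i / s i)"
      by (simp add: sum_distrib_left add_divide_distrib sum.distrib)
    also have "\<dots> \<le> 1"
      using * by (intro convex_bound_le) (auto simp: C_def)
    finally show "u *\<^sub>R x + w *\<^sub>R y \<in> C"
      using * by (auto simp: C_def)
  qed
  moreover have "E \<subseteq> C"
  proof -
    have "s i *\<^sub>R axis i 1 \<in> C" for i
    proof -
      have "(\<Sum>j\<in>UNIV. (s i *\<^sub>R axis i 1) $ j / s j) = (\<Sum>j\<in>UNIV. if j = i then 1 else 0)"
        using s[of i] by (intro sum.cong) (auto simp: axis_def)
      then show ?thesis
        using s[of i] by (auto simp: C_def axis_def)
    qed
    then show ?thesis
      by (auto simp: E_def C_def)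
  qed
  ultimately have "convex hull E \<subseteq> C"
    by (intro hull_minimal)
  moreover have "x \<in> convex hull E" if "x \<in> C" for x
  proof -
    \<comment> \<open>\<open>\<sigma>\<close> is the weight on the nonzero vertices. If it is
      positive, \<open>x\<close> is \<open>\<sigma>\<close> times a point \<open>y\<close> of the
      facet opposite 0, and the weight \<open>1 - \<sigma>\<close> falls on the vertex 0.\<close>
    define \<sigma> where "\<sigma> = (\<Sum>i\<in>UNIV. x $ i / s i)"
    have nn: "0 \<le> x $ i / s i" for i
      using that s[of i] by (auto simp: C_def)
    have 0: "0 \<in> convex hull E"
      by (auto simp: E_def intro: hull_inc)
    show ?thesis
    proof (cases "\<sigma> = 0")
      case True
      then have "x $ i / s i = 0" for i
        using nn by (simp add: \<sigma>_def sum_nonneg_eq_0_iff)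
      then have "x $ i = 0" for i
        using s[of i] by (metis divide_eq_0_iff less_irrefl)
      then have "x = 0"
        by (simp add: vec_eq_iff)
      then show ?thesis using 0 by simp
    next
      case False
      have \<sigma>: "0 < \<sigma>" "\<sigma> \<le> 1"
        using False nn that by (auto simp: \<sigma>_def C_def less_le sum_nonneg)
      define y where "y = (\<Sum>i\<in>UNIV. (x $ i / s i / \<sigma>) *\<^sub>R (s i *\<^sub>R axis i (1::real)))"
      have "y \<in> convex hull E"
        unfolding y_def
      proof (rule convex_sum)
        show "(\<Sum>i\<in>UNIV. x $ i / s i / \<sigma>) = 1"
          unfolding sum_divide_distrib[symmetric] using False by (simp add: \<sigma>_def)
        show "0 \<le> x $ i / s i / \<sigma>" for i
          by (rule divide_nonneg_pos[OF nn \<sigma>(1)])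
        show "s i *\<^sub>R axis i 1 \<in> convex hull E" for i
          by (auto simp: E_def intro: hull_inc)
      qed auto
      moreover have "\<sigma> *\<^sub>R y = x"
      proof -
        have "\<sigma> *\<^sub>R y = (\<Sum>i\<in>UNIV. x $ i *\<^sub>R axis i 1)"
          unfolding y_def scaleR_sum_right
          using \<sigma>(1) s by (intro sum.cong) (auto simp: less_imp_neq[THEN not_sym])
        then show ?thesis
          by (simp add: basis_expansion flip: scalar_mult_eq_scaleR)
      qed
      ultimately show ?thesis
        using convexD[OF convex_convex_hull[of E] 0, of y "1 - \<sigma>" \<sigma>] \<sigma> by simp
    qed
  qed
  ultimately show ?thesis
    unfolding T_simplex_def E_def C_def s_def by blast
qed

section \<open>The extremal simplex\<close>

lemma open_simplex_subset_interior_T_simplex: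
  fixes idx :: "'n::finite \<Rightarrow> nat"
  assumes "\<And>i. 0 < idx i" "\<And>i. 0 < x $ i" "(\<Sum>i\<in>UNIV. x $ i / real (sylvester (idx i))) < 1"
  shows "x \<in> interior (T_simplex idx)"
proof -
  define U where "U = {x::real^'n. (\<forall>i. 0 < x $ i) \<and> (\<Sum>i\<in>UNIV. x $ i / real (sylvester (idx i))) < 1}"
  have "open U"
    unfolding U_def Collect_conj_eq Collect_all_eq divide_inverse
    by (intro open_Int open_INT ballI open_Collect_less continuous_intros) auto
  moreover have "U \<subseteq> T_simplex idx"
    using T_simplex_eq[of idx] assms(1) by (auto simp: U_def less_imp_le)
  moreover have "x \<in> U"
    using assms by (simp add: U_def)
  ultimately show ?thesis
    by (meson interiorI)
qed

lemma interior_affine_image: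
  fixes l :: "'a::euclidean_space \<Rightarrow> 'a"
  assumes "linear l" "inj l"
  shows "interior ((\<lambda>x. l x + c) ` A) = (\<lambda>x. l x + c) ` interior A"
proof -
  have "(\<lambda>x. l x + c) ` B = (+) c ` (l ` B)" for B
    by (auto simp: image_image add.commute)
  then show ?thesis
    using interior_injective_linear_image[OF assms] by (simp add: interior_translation)
qed

lemma sum_inverse_sylvester_idx:
  fixes idx :: "'n::finite \<Rightarrow> nat"
  assumes "bij_betw idx UNIV {1..CARD('n)}"
  shows "(\<Sum>i\<in>UNIV. 1 / real (sylvester (idx i))) = 1 - 1 / (real (sylvester (CARD('n) + 1)) - 1)"
proof -
  have "(\<Sum>i\<in>UNIV. 1 / real (sylvester (idx i))) = (\<Sum>k\<in>{1..CARD('n)}. 1 / real (sylvester k))"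
    by (rule sum.reindex_bij_betw[OF assms])
  also have "\<dots> = (\<Sum>k<CARD('n). 1 / real (sylvester (Suc k)))"
    by (rule sum.reindex_bij_witness[of _ Suc "\<lambda>k. k - 1"]) auto
  finally show ?thesis
    by (simp add: sum_inverse_sylvester)
qed

lemma sylvester_CARD_ge_3: "3 \<le> sylvester (CARD('n::finite) + 1)"
proof -
  have "sylvester (Suc 0) < sylvester (Suc CARD('n))"
    by (rule sylvester_Suc_strict_mono) (simp add: card_gt_0_iff)
  then show ?thesis
    using sylvester_Suc_ge_2[of 0] by simp
qed

text \<open>The affine map \<open>g\<close> sends 0 to \<open>v\<close>, each s_i e_i to
  \<open>w i\<close> and, by \<open>zero\<close>, the all-ones vector \<open>u\<close> to 0. Its
  inverse is the required equivalence once \<open>g\<close> is shown to preserve the lattice in both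
  directions and \<open>P\<close> to lie inside the image of the simplex.\<close>

lemma unimod_equiv_T_simplex_if_extremal:
  fixes P :: "(real^'n) set" and idx :: "'n \<Rightarrow> nat" and w :: "'n \<Rightarrow> real^'n"
  defines "s \<equiv> \<lambda>i. real (sylvester (idx i))"
  assumes idx: "bij_betw idx UNIV {1..CARD('n)}"
    and "convex P" and only: "interior P \<inter> int_points = {0}"
    and v: "v \<in> P" "v \<in> int_points" and w: "\<And>i. w i \<in> P" "\<And>i. w i \<in> int_points"
    and h: "\<And>p. p \<in> P \<Longrightarrow> h \<bullet> p \<le> c" "\<And>i. h \<bullet> w i = c" "h \<bullet> v < c"
    and zero: "v + (\<Sum>i\<in>UNIV. (1 / s i) *\<^sub>R (w i - v)) = 0"
    and indep: "\<And>x i. (\<Sum>i\<in>UNIV. x i *\<^sub>R (w i - v)) = 0 \<Longrightarrow> x i = 0"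
  shows "unimod_equiv P (T_simplex idx)"
proof -
  have idxpos: "0 < idx i" for i
    using bij_betwE[OF idx] by (simp add: Suc_le_eq)
  have idx_inj: "idx i \<noteq> idx j" if "i \<noteq> j" for i j
    using idx that by (auto simp: bij_betw_def inj_def)
  have s: "0 < s i" for i
    using sylvester_Suc_pos[of "idx i - 1"] idxpos[of i] by (simp add: s_def)
  have sum1: "(\<Sum>i\<in>UNIV. 1 / s i) < 1"
    using sylvester_CARD_ge_3[where 'n='n] unfolding s_def sum_inverse_sylvester_idx[OF idx] by simp
  define L where "L x = (\<Sum>i\<in>UNIV. (x $ i / s i) *\<^sub>R (w i - v))" for x :: "real^'n"
  have "linear L"
    by (rule linearI)
      (simp_all add: L_def add_divide_distrib scaleR_left_distrib sum.distrib scaleR_sum_right)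
  have "inj L"
    unfolding linear_injective_0[OF \<open>linear L\<close>]
  proof (intro allI impI)
    fix x assume "L x = 0"
    then have "x $ i / s i = 0" for i
      unfolding L_def by (rule indep)
    then show "x = 0"
      using s by (auto simp: vec_eq_iff less_imp_neq[THEN not_sym])
  qed
  then have "bij L"
    using \<open>linear L\<close> by (simp add: bij_def linear_injective_imp_surjective)
  define g where "g x = L x + v" for x
  have "bij g"
  proof -
    have "g = (\<lambda>y. y + v) \<circ> L"
      by (auto simp: g_def)
    moreover have "bij (\<lambda>y. y + v)"
      by (rule bij_plus_right)
    ultimately show ?thesis
      using \<open>bij L\<close> bij_comp by blast
  qed
  define u where "u = ((\<chi> i. 1) :: real^'n)"
  have gu: "g u = 0"
    using zero by (simp add: g_def L_def u_def add.commute)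
  have axis: "L (axis i 1) = (1 / s i) *\<^sub>R (w i - v)" for i
  proof -
    have "L (axis i 1) = (\<Sum>j\<in>UNIV. if j = i then (1 / s i) *\<^sub>R (w i - v) else 0)"
      unfolding L_def by (intro sum.cong) (auto simp: axis_def)
    then show ?thesis by simp
  qed
  have "g ` T_simplex idx \<subseteq> P"
  proof -
    have "convex (g -` P)"
    proof -
      have "g -` P = L -` ((+) (- v) ` P)"
        by (force simp: g_def image_iff)
      then show ?thesis
        using convex_linear_vimage[OF \<open>linear L\<close>] convex_translation[OF \<open>convex P\<close>] by metis
    qed
    moreover have "s i *\<^sub>R axis i 1 \<in> g -` P" for i
      using s[of i] w(1)[of i] by (simp add: g_def linear_scale[OF \<open>linear L\<close>] axis)
    ultimately have "T_simplex idx \<subseteq> g -` P"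
      unfolding T_simplex_def s_def
      using v(1) linear_0[OF \<open>linear L\<close>] by (intro hull_minimal) (auto simp: g_def)
    then show ?thesis by auto
  qed
  then have interior_g: "g x \<in> interior P" if "\<And>i. 0 < x $ i" "(\<Sum>i\<in>UNIV. x $ i / s i) < 1" for x
  proof -
    have "g ` interior (T_simplex idx) = interior (g ` T_simplex idx)"
      unfolding g_def using \<open>linear L\<close> \<open>inj L\<close> by (rule interior_affine_image[symmetric])
    then have "g x \<in> interior (g ` T_simplex idx)"
      using open_simplex_subset_interior_T_simplex[OF idxpos, of x] that by (auto simp: s_def)
    then show ?thesis
      using \<open>g ` T_simplex idx \<subseteq> P\<close> interior_mono by blast
  qed
  have Lu: "L u = - v"
    using gu by (simp add: g_def eq_neg_iff_add_eq_0)
  txt \<open>The Sylvester numbers are pairwise coprime, so \<open>e\<^sub>i\<close> is an integer combination of the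
    all-ones vector and the vectors \<open>s\<^sub>j e\<^sub>j\<close>, all of which \<open>L\<close> maps to lattice points.\<close>
  have L_axis_int: "L (axis i 1) \<in> int_points" for i
  proof -
    \<comment> \<open>\<open>M\<close> clears all denominators except \<open>s i\<close>, so
      \<open>M\<close> times \<open>L u\<close> shows \<open>(M / s i) *\<^sub>R (w i - v)\<close>
      to be a lattice vector. Bezout combines it with \<open>w i - v\<close> to reach the factor
      \<open>1 / s i\<close>.\<close>
    define M where "M = (\<Prod>j\<in>UNIV - {i}. sylvester (idx j))"
    have "coprime (sylvester (idx i)) (sylvester (idx j))" if "j \<noteq> i" for j
    proof -
      have "coprime (sylvester (Suc (idx i - 1))) (sylvester (Suc (idx j - 1)))"
        using idx_inj[OF that] idxpos[of i] idxpos[of j] by (intro coprime_sylvester) linarith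
      then show ?thesis
        using idxpos[of i] idxpos[of j] by simp
    qed
    then have "coprime (sylvester (idx i)) M"
      unfolding M_def by (intro prod_coprime_right) auto
    then have "coprime (int M) (int (sylvester (idx i)))"
      by (simp add: coprime_commute)
    then obtain a b where "a * int M + b * int (sylvester (idx i)) = 1"
      by (metis bezout_int coprime_iff_gcd_eq_1)
    then have "real_of_int (a * int M + b * int (sylvester (idx i))) = 1"
      by (simp only: of_int_1)
    then have ab: "of_int a * real M + of_int b * s i = 1"
      by (simp add: s_def)
    have div: "real M / s j \<in> \<int>" if "j \<noteq> i" for j
    proof -
      have "sylvester (idx j) dvd M"
        unfolding M_def using that by (intro dvd_prodI) auto
      then obtain k where "M = sylvester (idx j) * k" ..
      then have "real M / s j = real k"
        using s[of j] by (simp add: s_def)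
      then show ?thesis by simp
    qed
    have "(\<Sum>j\<in>UNIV - {i}. (real M / s j) *\<^sub>R (w j - v)) \<in> int_points"
      using div v w by (intro int_points_sum int_points_scaleR int_points_diff) auto
    moreover have "real M *\<^sub>R L u = (real M / s i) *\<^sub>R (w i - v)
        + (\<Sum>j\<in>UNIV - {i}. (real M / s j) *\<^sub>R (w j - v))"
      by (simp add: L_def u_def scaleR_sum_right scaleR_add_right sum.remove[of UNIV i])
    ultimately have "real M *\<^sub>R L u - (real M / s i) *\<^sub>R (w i - v) \<in> int_points"
      by simp
    moreover have "real M *\<^sub>R L u \<in> int_points"
      unfolding Lu using v by (intro int_points_scaleR int_points_uminus) auto
    ultimately have *: "(real M / s i) *\<^sub>R (w i - v) \<in> int_points"
      using int_points_diff by fastforce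
    have "L (axis i 1) = (of_int a * real M + of_int b * s i) *\<^sub>R ((1 / s i) *\<^sub>R (w i - v))"
      unfolding ab axis by simp
    also have "\<dots> = of_int a *\<^sub>R ((real M / s i) *\<^sub>R (w i - v)) + of_int b *\<^sub>R (w i - v)"
      using s[of i] by (simp add: scaleR_left_distrib add_divide_distrib)
    also have "\<dots> \<in> int_points"
      by (rule int_points_add[OF int_points_scaleR[OF _ *] int_points_scaleR[OF _ int_points_diff]])
        (use v w in auto)
    finally show ?thesis .
  qed
  have L_expand: "L x = (\<Sum>i\<in>UNIV. x $ i *\<^sub>R L (axis i 1))" for x
    unfolding axis L_def[of x] by simp
  have L_int: "L x \<in> int_points" if "x \<in> int_points" for x
    unfolding L_expand[of x] using that L_axis_int
    by (intro int_points_sum int_points_scaleR) (auto simp: int_points_def)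
  have g_int: "g x \<in> int_points" if "x \<in> int_points" for x
    unfolding g_def using that L_int v by (intro int_points_add) auto
  txt \<open>If the lattice were larger, some \<open>x\<close> with entries in \<open>[0, 1)\<close> would map to it, and \<open>u - x\<close>
    would be a second interior lattice point.\<close>
  have g_int_conv: "x \<in> int_points" if "g x \<in> int_points" for x
  proof -
    define f where "f = ((\<chi> i. of_int \<lfloor>x $ i\<rfloor>) :: real^'n)"
    have "f \<in> int_points"
      by (simp add: f_def int_points_def)
    define y where "y = u - (x - f)"
    have y: "0 < y $ i" "y $ i \<le> 1" for i
      using of_int_floor_le[of "x $ i"] floor_correct[of "x $ i"]
      unfolding y_def u_def f_def by (simp_all, linarith)
    have "g y = g u - g x + g f"
      by (simp add: y_def g_def linear_diff[OF \<open>linear L\<close>])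
    also have "\<dots> \<in> int_points"
      unfolding gu using that g_int[OF \<open>f \<in> int_points\<close>]
      by (intro int_points_add int_points_diff) (auto simp: int_points_def)
    finally have "g y \<in> int_points" .
    moreover have "g y \<in> interior P"
    proof (rule interior_g)
      have "(\<Sum>i\<in>UNIV. y $ i / s i) \<le> (\<Sum>i\<in>UNIV. 1 / s i)"
        using y s by (intro sum_mono divide_right_mono) (auto simp: less_imp_le)
      then show "(\<Sum>i\<in>UNIV. y $ i / s i) < 1"
        using sum1 by linarith
    qed (rule y)
    ultimately have "g y = g u"
      using only gu by auto
    then have "y = u"
      using \<open>bij g\<close> by (metis bij_is_inj injD)
    then have "x = f"
      by (simp add: y_def)
    then show ?thesis using \<open>f \<in> int_points\<close> by simp
  qed
  \<comment> \<open>Pulled back along \<open>g\<close>, the inequality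
    \<open>h \<bullet> p \<le> c\<close> is the facet inequality opposite 0.\<close>
  have sum_h: "h \<bullet> g x = h \<bullet> v + (\<Sum>i\<in>UNIV. x $ i / s i) * (c - h \<bullet> v)" for x
    by (simp add: g_def L_def inner_add_right inner_sum_right inner_diff_right h sum_distrib_right)
  txt \<open>A point of \<open>P\<close> beyond the facet \<open>x\<^sub>i = 0\<close> would make the lattice point \<open>u - e\<^sub>i\<close> in the
    relative interior of this facet an interior point of \<open>P\<close>.\<close>
  have P_sub: "x \<in> T_simplex idx" if "g x \<in> P" for x
  proof -
    have "(\<Sum>i\<in>UNIV. x $ i / s i) * (c - h \<bullet> v) \<le> 1 * (c - h \<bullet> v)"
      using h(1)[OF that] by (simp add: sum_h)
    then have le1: "(\<Sum>i\<in>UNIV. x $ i / s i) \<le> 1"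
      using h(3) mult_le_cancel_right_pos[of "c - h \<bullet> v"] by simp
    have "0 \<le> x $ i" for i
    proof (rule ccontr)
      assume neg: "\<not> 0 \<le> x $ i"
      define q where "q = u - axis i 1"
      have q: "q $ i = 0" "\<And>j. j \<noteq> i \<Longrightarrow> q $ j = 1"
        by (auto simp: q_def u_def axis_def)
      have "q \<in> int_points"
        by (auto simp: int_points_def q_def u_def axis_def)
      have sumq: "(\<Sum>j\<in>UNIV. q $ j / s j) < 1"
      proof -
        have "(\<Sum>j\<in>UNIV. q $ j / s j) \<le> (\<Sum>j\<in>UNIV. 1 / s j)"
          using s by (intro sum_mono divide_right_mono) (auto simp: q_def u_def axis_def less_imp_le)
        then show ?thesis using sum1 by linarith
      qed
      \<comment> \<open>\<open>r \<theta>\<close> continues the segment from \<open>x\<close> beyond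
        \<open>q\<close>. Since \<open>x $ i < 0\<close>, its \<open>i\<close>-th coordinate is
        positive, so for small \<open>\<theta>\<close> it lies in the open simplex, and
        \<open>q\<close> lies strictly between it and \<open>x\<close>.\<close>
      define r where "r \<theta> = q + \<theta> *\<^sub>R (q - x)" for \<theta> :: real
      have "\<forall>\<^sub>F \<theta> in at_right 0. 0 < r \<theta> $ j" for j
      proof (cases "j = i")
        case True
        then show ?thesis
          using neg by (auto simp: r_def q eventually_at_right_less intro!: eventually_at_rightI[of 0 1]
              mult_pos_neg)
      next
        case False
        have "((\<lambda>\<theta>. r \<theta> $ j) \<longlongrightarrow> (q + 0 *\<^sub>R (q - x)) $ j) (at_right 0)"
          unfolding r_def by (intro tendsto_intros)
        then show ?thesis
          using q(2)[OF False] by (intro order_tendstoD(1)) auto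
      qed
      moreover have "\<forall>\<^sub>F \<theta> in at_right 0. (\<Sum>j\<in>UNIV. r \<theta> $ j / s j) < 1"
      proof -
        have "((\<lambda>\<theta>. \<Sum>j\<in>UNIV. r \<theta> $ j / s j) \<longlongrightarrow> (\<Sum>j\<in>UNIV. (q + 0 *\<^sub>R (q - x)) $ j / s j)) (at_right 0)"
          unfolding r_def by (intro tendsto_intros) (use s in \<open>auto simp: less_imp_neq[THEN not_sym]\<close>)
        then show ?thesis
          using sumq by (intro order_tendstoD(2)) auto
      qed
      moreover have "\<forall>\<^sub>F \<theta> in at_right 0. 0 < (\<theta>::real)"
        by (rule eventually_at_right_less)
      ultimately have "\<forall>\<^sub>F \<theta> in at_right 0. (\<forall>j. 0 < r \<theta> $ j) \<and> (\<Sum>j\<in>UNIV. r \<theta> $ j / s j) < 1 \<and> 0 < \<theta>"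
        by (simp add: eventually_conj_iff eventually_all_finite)
      then obtain \<theta> where \<theta>: "\<And>j. 0 < r \<theta> $ j" "(\<Sum>j\<in>UNIV. r \<theta> $ j / s j) < 1" "0 < \<theta>"
        using eventually_happens'[OF trivial_limit_at_right_real] by blast
      have "g (r \<theta>) \<in> interior P"
        using \<theta> by (intro interior_g) auto
      then have "g x - (1 / (1 + \<theta>)) *\<^sub>R (g x - g (r \<theta>)) \<in> interior P"
        using \<theta>(3) \<open>convex P\<close> that closure_subset
        by (intro mem_interior_closure_convex_shrink) auto
      also have "g x - (1 / (1 + \<theta>)) *\<^sub>R (g x - g (r \<theta>)) = g (x - (1 / (1 + \<theta>)) *\<^sub>R (x - r \<theta>))"
        by (simp add: g_def linear_diff[OF \<open>linear L\<close>] linear_scale[OF \<open>linear L\<close>])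
      also have "x - r \<theta> = (1 + \<theta>) *\<^sub>R (x - q)"
        by (simp add: r_def algebra_simps)
      also have "x - (1 / (1 + \<theta>)) *\<^sub>R ((1 + \<theta>) *\<^sub>R (x - q)) = q"
        using \<theta>(3) by simp
      finally have "g q = g u"
        using only g_int[OF \<open>q \<in> int_points\<close>] gu by auto
      then have "q = u"
        using \<open>bij g\<close> by (metis bij_is_inj injD)
      then show False
        using q(1) by (simp add: u_def)
    qed
    then show ?thesis
      using le1 by (simp add: T_simplex_eq[OF idxpos] s_def)
  qed
  obtain L' where L': "linear L'" "L' \<circ> L = id"
    using linear_injective_left_inverse[OF \<open>linear L\<close> \<open>inj L\<close>] by blast
  have L'L: "L' (L x) = x" for x
    using L'(2) by (metis comp_apply id_apply)
  define f where "f y = L' y + (- L' v)" for y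
  have fg: "f (g x) = x" for x
    by (simp add: f_def g_def linear_add[OF L'(1)] L'L)
  have f_inv: "f = inv g"
    using fg \<open>bij g\<close> by (metis bij_is_surj ext surj_f_inv_f)
  have image: "f ` A = {x. g x \<in> A}" for A
    unfolding f_inv by (simp add: bij_vimage_eq_inv_image[OF \<open>bij g\<close>, symmetric] vimage_def)
  show ?thesis
    unfolding unimod_equiv_def
  proof (rule exI[of _ f], intro conjI)
    show "bij f"
      unfolding f_inv using \<open>bij g\<close> by (rule bij_imp_bij_inv)
    have "f = (\<lambda>x. L' x + - L' v)"
      by (auto simp: f_def)
    then show "\<exists>l c. linear l \<and> f = (\<lambda>x. l x + c)"
      using L'(1) by blast
    show "f ` int_points = int_points"
      unfolding image by (rule set_eqI) (simp add: iffI[OF g_int_conv g_int])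
    show "f ` P = T_simplex idx"
      unfolding image using P_sub \<open>g ` T_simplex idx \<subseteq> P\<close> by blast
  qed
qed

section \<open>The coefficient of asymmetry\<close>

text \<open>\<open>1 / t\<close> is the ratio at \<open>v\<close>, and
  \<open>\<beta> v = t / (1 + t)\<close> in the simplex around the origin.
  \<open>product_sum_residual_ge\<close> bounds \<open>\<beta> v\<close> from below in terms of
  \<open>card W\<close>, which is at most the dimension; monotonicity of the Sylvester numbers does
  the rest.\<close>

lemma simplex_bound:
  fixes S :: "(real^'n) set" and idx :: "'n \<Rightarrow> nat"
  assumes idx: "bij_betw idx UNIV {1..CARD('n)}"
    and S: "finite S" "S \<subseteq> int_points" and only: "interior (convex hull S) \<inter> int_points = {0}"
    and v: "v \<in> S" "0 < t" "- (t *\<^sub>R v) \<in> frontier (convex hull S)"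
  shows "1 / t \<le> real (sylvester (CARD('n) + 1)) - 2"
    and "real (sylvester (CARD('n) + 1)) - 2 \<le> 1 / t \<Longrightarrow> unimod_equiv (convex hull S) (T_simplex idx)"
proof -
  define P where "P = convex hull S"
  have int0: "0 \<in> interior P"
    using only by (auto simp: P_def)
  obtain W \<beta> h c where W: "W \<subseteq> S" "v \<notin> W" "\<not> affine_dependent (insert v W)"
    and h: "\<And>p. p \<in> convex hull S \<Longrightarrow> h \<bullet> p \<le> c" "\<And>w. w \<in> W \<Longrightarrow> h \<bullet> w = c" "h \<bullet> v < c"
    and \<beta>: "\<And>u. u \<in> insert v W \<Longrightarrow> 0 < \<beta> u" "sum \<beta> (insert v W) = 1"
      "(\<Sum>u\<in>insert v W. \<beta> u *\<^sub>R u) = 0" "\<beta> v = t / (1 + t)"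
    by (rule ex_simplex_around_origin[OF S(1) int0[unfolded P_def] v]) blast
  have fin: "finite W"
    using W(1) S(1) finite_subset by blast
  have "insert v W \<subseteq> P"
    unfolding P_def using W(1) v(1) by (auto intro: hull_inc)
  have only': "(\<Sum>u\<in>insert v W. \<gamma> u *\<^sub>R u) = 0"
    if "\<And>u. u \<in> insert v W \<Longrightarrow> 0 < \<gamma> u" "sum \<gamma> (insert v W) = 1"
      "(\<Sum>u\<in>insert v W. \<gamma> u *\<^sub>R u) \<in> int_points" for \<gamma>
  proof -
    have "(\<Sum>u\<in>insert v W. \<gamma> u *\<^sub>R u) \<in> interior P"
      by (rule positive_combination_in_interior[OF _ int0 _ \<open>insert v W \<subseteq> P\<close> \<beta>(1-3) that(1,2)])
        (use fin in \<open>auto simp: P_def\<close>)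
    then show ?thesis
      using only that(3) by (auto simp: P_def)
  qed
  \<comment> \<open>Subsets of \<open>W\<close> omit \<open>v\<close> and are therefore proper in
    \<open>insert v W\<close>.\<close>
  have prod: "prod \<beta> J \<le> 1 - sum \<beta> J" if "J \<subseteq> W" for J
    by (rule product_sum_inequality[OF _ _ W(3) \<beta>(1-3) only'])
      (use fin W(1,2) S(2) v(1) that in auto)
  have \<beta>W: "1 - sum \<beta> W = t / (1 + t)"
    using \<beta>(2,4) fin W(2) by simp
  note res = product_sum_residual_ge[OF fin, of \<beta>, OF _ prod, unfolded \<beta>W]
  have card: "card W \<le> CARD('n)"
  proof -
    have "int (card (insert v W)) - 1 = aff_dim (insert v W)"
      using W(3) by (simp add: affine_independent_iff_card)
    also have "\<dots> \<le> int CARD('n)"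
      using aff_dim_le_DIM[of "insert v W"] by simp
    finally show ?thesis
      using fin W(2) by simp
  qed
  define s where "s k = real (sylvester (Suc k))" for k
  have s2: "2 \<le> s k" for k
    using sylvester_Suc_ge_2[of k] by (simp add: s_def)
  have s_less: "s k < s l" if "k < l" for k l
    using sylvester_Suc_strict_mono[OF that] by (simp add: s_def)
  have "1 / (s (card W) - 1) \<le> t / (1 + t)"
    unfolding s_def using \<beta>(1) by (intro res) auto
  then have "(1 + t) / t \<le> s (card W) - 1"
    using s2[of "card W"] v(2) by (simp add: field_simps)
  moreover have "(1 + t) / t = 1 / t + 1"
    using v(2) by (simp add: field_simps)
  ultimately have bound: "1 / t \<le> s (card W) - 2"
    by linarith
  moreover have "s (card W) \<le> s CARD('n)"
    using card s_less[of "card W" "CARD('n)"] by (cases "card W = CARD('n)") auto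
  ultimately show "1 / t \<le> real (sylvester (CARD('n) + 1)) - 2"
    by (simp add: s_def)
  assume "real (sylvester (CARD('n) + 1)) - 2 \<le> 1 / t"
  then have eq: "s CARD('n) - 2 \<le> 1 / t"
    by (simp add: s_def)
  \<comment> \<open>Strict monotonicity excludes a simplex of lower dimension.\<close>
  then have cardW: "card W = CARD('n)"
    using card bound s_less[of "card W" "CARD('n)"] by (cases "card W < CARD('n)") auto
  have "1 / t = s (card W) - 2"
    using eq bound cardW by simp
  then have "t / (1 + t) = 1 / (s (card W) - 1)"
    using v(2) s2[of "card W"] by (simp add: field_simps)
  then have "\<exists>e. bij_betw e {..<card W} W \<and> (\<forall>i<card W. \<beta> (e i) = 1 / real (sylvester (Suc i)))"
    unfolding s_def using \<beta>(1) by (intro res) auto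
  then obtain e where e: "bij_betw e {..<CARD('n)} W"
    "\<And>i. i < CARD('n) \<Longrightarrow> \<beta> (e i) = 1 / real (sylvester (Suc i))"
    by (auto simp: cardW)
  \<comment> \<open>\<open>idx\<close> counts from 1, \<open>e\<close> from 0.\<close>
  define w where "w i = e (idx i - 1)" for i
  have idx1: "1 \<le> idx i" "idx i - 1 < CARD('n)" for i
    using bij_betwE[OF idx] by (auto simp: Suc_le_eq) (metis Suc_pred less_Suc_eq_le not_less)
  have w: "bij_betw w UNIV W"
  proof -
    have pred: "bij_betw (\<lambda>k. k - 1) {1..CARD('n)} {..<CARD('n)}"
      by (rule bij_betw_byWitness[where f' = Suc]) auto
    have "bij_betw (e \<circ> ((\<lambda>k. k - 1) \<circ> idx)) UNIV W"
      by (rule bij_betw_trans[OF bij_betw_trans[OF idx pred] e(1)])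
    moreover have "e \<circ> ((\<lambda>k. k - 1) \<circ> idx) = w"
      by (auto simp: w_def)
    ultimately show ?thesis by simp
  qed
  have \<beta>w: "\<beta> (w i) = 1 / real (sylvester (idx i))" for i
    using e(2)[OF idx1(2)[of i]] idx1(1)[of i] by (simp add: w_def)
  have wW: "w i \<in> W" for i
    using w by (auto simp: bij_betw_def)
  have sumW: "(\<Sum>i\<in>UNIV. f (w i)) = sum f W" for f :: "real^'n \<Rightarrow> 'b::comm_monoid_add"
    by (rule sum.reindex_bij_betw[OF w])
  show "unimod_equiv (convex hull S) (T_simplex idx)"
  proof (rule unimod_equiv_T_simplex_if_extremal[OF idx _ only, of v w h c])
    show "convex (convex hull S)" by simp
    show "v \<in> convex hull S" "v \<in> int_points"
      using v(1) S(2) by (auto intro: hull_inc)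
    show "w i \<in> convex hull S" "w i \<in> int_points" "h \<bullet> w i = c" for i
      using wW[of i] W(1) S(2) h(2) by (auto intro: hull_inc)
    show "v + (\<Sum>i\<in>UNIV. (1 / real (sylvester (idx i))) *\<^sub>R (w i - v)) = 0"
    proof -
      have "(\<Sum>i\<in>UNIV. (1 / real (sylvester (idx i))) *\<^sub>R (w i - v)) = (\<Sum>x\<in>W. \<beta> x *\<^sub>R (x - v))"
        unfolding \<beta>w[symmetric] by (rule sumW)
      also have "\<dots> = (\<Sum>x\<in>W. \<beta> x *\<^sub>R x) - sum \<beta> W *\<^sub>R v"
        by (simp add: scaleR_right_diff_distrib sum_subtractf scaleR_sum_left)
      also have "sum \<beta> W = 1 - \<beta> v"
        using \<beta>(2) fin W(2) by simp
      also have "(\<Sum>x\<in>W. \<beta> x *\<^sub>R x) = - (\<beta> v *\<^sub>R v)"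
        using \<beta>(3) fin W(2) by (simp add: eq_neg_iff_add_eq_0 add.commute)
      finally show ?thesis
        by (simp add: scaleR_left_diff_distrib)
    qed
    show "x i = 0" if "(\<Sum>i\<in>UNIV. x i *\<^sub>R (w i - v)) = 0" for x i
    proof (rule ccontr)
      assume "x i \<noteq> 0"
      define y where "y = x \<circ> inv w"
      have inv: "inv w (w i) = i" for i
        using w by (intro inv_f_f) (auto simp: bij_betw_def)
      have "(\<Sum>i\<in>UNIV. x i *\<^sub>R (w i - v)) = (\<Sum>i\<in>UNIV. y (w i) *\<^sub>R (w i - v))"
        by (simp add: y_def inv)
      also have "\<dots> = (\<Sum>a\<in>W. y a *\<^sub>R (a - v))"
        by (rule sumW)
      finally have "(\<Sum>a\<in>W. y a *\<^sub>R (a - v)) = 0"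
        using that by simp
      then have y0: "(\<Sum>a\<in>W. y a *\<^sub>R a) = sum y W *\<^sub>R v"
        by (simp add: scaleR_right_diff_distrib sum_subtractf scaleR_sum_left)
      \<comment> \<open>Giving \<open>v\<close> the coefficient \<open>- sum y W\<close> turns a
        relation among the edge vectors into an affine dependence.\<close>
      define U where "U a = (if a = v then - sum y W else y a)" for a
      have UW: "U a = y a" if "a \<in> W" for a
        using that W(2) by (auto simp: U_def)
      have "sum U (insert v W) = 0" "(\<Sum>a\<in>insert v W. U a *\<^sub>R a) = 0"
        using fin W(2) UW y0 by (simp_all add: U_def[of v] cong: sum.cong)
      moreover have "U (w i) \<noteq> 0"
        using \<open>x i \<noteq> 0\<close> wW[of i] by (simp add: UW y_def inv)
      ultimately have "affine_dependent (insert v W)"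
        using fin wW[of i] by (auto simp: affine_dependent_explicit_finite)
      then show False
        using W(3) by simp
    qed
  qed (use h in auto)
qed

text \<open>The equivalence must send 0 to the all-ones vector \<open>o1\<close>, an interior
  lattice point of the simplex. The line through 0 and \<open>o1\<close> leaves the simplex at 0 and
  at \<open>((m + 1) / m) *\<^sub>R o1\<close>, at distances from \<open>o1\<close> in ratio
  \<open>m\<close>; both ends are pulled back to \<open>P\<close>.\<close>

lemma T_simplex_attains_asymmetry:
  fixes P :: "(real^'n) set" and idx :: "'n \<Rightarrow> nat"
  assumes idx: "bij_betw idx UNIV {1..CARD('n)}"
    and only: "interior P \<inter> int_points = {0}"
    and "unimod_equiv P (T_simplex idx)"
  obtains a b where "a \<in> frontier P" "b \<in> frontier P" "0 \<in> closed_segment a b"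
    "norm a / norm b = real (sylvester (CARD('n) + 1)) - 2"
proof -
  obtain f l c where f: "bij f" "linear l" "f = (\<lambda>x. l x + c)" "f ` int_points = int_points"
    "f ` P = T_simplex idx"
    using assms(3) unfolding unimod_equiv_def by blast
  have l_eq: "l x = f x - c" for x
    by (simp add: f(3))
  have "inj l" "surj l"
  proof -
    show "inj l"
      using bij_is_inj[OF f(1)] by (simp add: l_eq inj_def)
    then show "surj l"
      using f(2) by (simp add: linear_injective_imp_surjective)
  qed
  have idxpos: "0 < idx i" for i
    using bij_betwE[OF idx] by (simp add: Suc_le_eq)
  define m where "m = real (sylvester (CARD('n) + 1)) - 2"
  have m: "1 \<le> m"
    using sylvester_CARD_ge_3[where 'n='n] by (simp add: m_def)
  have sum_inv: "(\<Sum>i\<in>UNIV. 1 / real (sylvester (idx i))) = m / (m + 1)"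
    using m unfolding sum_inverse_sylvester_idx[OF idx] by (simp add: m_def field_simps)
  define o1 where "o1 = ((\<chi> i. 1) :: real^'n)"
  have "o1 \<in> int_points"
    by (simp add: o1_def int_points_def)
  have scaled_in_T: "r *\<^sub>R o1 \<in> T_simplex idx \<longleftrightarrow> 0 \<le> r \<and> r * (m / (m + 1)) \<le> 1" for r
  proof -
    have "(\<Sum>i\<in>UNIV. (r *\<^sub>R o1) $ i / real (sylvester (idx i))) = r * (m / (m + 1))"
      unfolding sum_inv[symmetric] sum_distrib_left by (simp add: o1_def)
    then show ?thesis
      by (simp add: T_simplex_eq[OF idxpos] o1_def)
  qed
  have "o1 \<in> interior (T_simplex idx)"
    using sum_inv m by (intro open_simplex_subset_interior_T_simplex idxpos) (auto simp: o1_def)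
  also have "interior (T_simplex idx) = f ` interior P"
    unfolding f(5)[symmetric] f(3) by (rule interior_affine_image[OF f(2) \<open>inj l\<close>])
  finally obtain y where y: "y \<in> interior P" "f y = o1"
    by auto
  moreover have preimage_int: "x \<in> int_points" if "f x \<in> int_points" for x
    using that f(4) bij_is_inj[OF f(1)] by (metis image_iff injD)
  ultimately have "y = 0"
    using only \<open>o1 \<in> int_points\<close> by (metis IntI singletonD)
  then have c: "c = o1"
    using y(2) linear_0[OF f(2)] by (simp add: f(3))
  obtain u where u: "l u = o1"
    using \<open>surj l\<close> by (metis surjD)
  have "u \<noteq> 0"
  proof
    assume "u = 0"
    then have "o1 = 0"
      using u linear_0[OF f(2)] by simp
    then show False
      by (simp add: o1_def vec_eq_iff)
  qed
  have fu: "f (r *\<^sub>R u) = (r + 1) *\<^sub>R o1" for r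
    by (simp add: f(3) linear_scale[OF f(2)] u c scaleR_left_distrib)
  have P_iff: "x \<in> P \<longleftrightarrow> f x \<in> T_simplex idx" for x
    unfolding f(5)[symmetric] using bij_is_inj[OF f(1)] by (simp add: inj_image_mem_iff)
  have in_P: "r *\<^sub>R u \<in> P \<longleftrightarrow> 0 \<le> r + 1 \<and> (r + 1) * (m / (m + 1)) \<le> 1" for r
    unfolding P_iff fu by (rule scaled_in_T)
  show thesis
  proof (rule that[of "(- 1) *\<^sub>R u" "(1 / m) *\<^sub>R u"])
    have "(- 1) *\<^sub>R u \<in> P"
      unfolding in_P by simp
    \<comment> \<open>\<open>f\<close> maps \<open>- u\<close> to the vertex 0, so
      \<open>- u\<close> is a nonzero lattice point and cannot be interior.\<close>
    moreover have "(- 1) *\<^sub>R u \<notin> interior P"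
    proof
      assume "(- 1) *\<^sub>R u \<in> interior P"
      moreover have "(- 1) *\<^sub>R u \<in> int_points"
        by (rule preimage_int, unfold fu) (simp add: int_points_def)
      ultimately have "(- 1) *\<^sub>R u = 0"
        using only by blast
      then show False
        using \<open>u \<noteq> 0\<close> by simp
    qed
    ultimately show "(- 1) *\<^sub>R u \<in> frontier P"
      using closure_subset by (auto simp: frontier_def)
    have "(1 / m) *\<^sub>R u \<in> P"
      unfolding in_P using m by (simp add: field_simps)
    moreover have "(1 / m) *\<^sub>R u \<notin> interior P"
    proof
      assume "(1 / m) *\<^sub>R u \<in> interior P"
      then obtain \<epsilon> where \<epsilon>: "0 < \<epsilon>" "ball ((1 / m) *\<^sub>R u) \<epsilon> \<subseteq> P"
        by (meson mem_interior)
      define \<delta> where "\<delta> = \<epsilon> / (2 * norm u)"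
      have \<delta>: "0 < \<delta>" "\<delta> * norm u < \<epsilon>"
        using \<epsilon>(1) \<open>u \<noteq> 0\<close> by (auto simp: \<delta>_def)
      have "(1 / m + \<delta>) *\<^sub>R u \<in> ball ((1 / m) *\<^sub>R u) \<epsilon>"
        using \<delta> by (simp add: dist_norm scaleR_left_distrib)
      then have "(1 / m + \<delta>) *\<^sub>R u \<in> P"
        using \<epsilon>(2) by blast
      then have "(1 / m + \<delta> + 1) * (m / (m + 1)) \<le> 1"
        unfolding in_P by simp
      moreover have "1 / m + 1 = (m + 1) / m"
        using m by (simp add: add_divide_distrib)
      then have "(1 / m + 1) * (m / (m + 1)) = 1"
        using m by simp
      then have "(1 / m + \<delta> + 1) * (m / (m + 1)) = 1 + \<delta> * (m / (m + 1))"
        by (simp only: distrib_right)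
      moreover have "0 < \<delta> * (m / (m + 1))"
        using m \<delta>(1) by simp
      ultimately show False
        by linarith
    qed
    ultimately show "(1 / m) *\<^sub>R u \<in> frontier P"
      using closure_subset by (auto simp: frontier_def)
    have "0 = (1 - m / (m + 1)) *\<^sub>R ((- 1) *\<^sub>R u) + (m / (m + 1)) *\<^sub>R ((1 / m) *\<^sub>R u)"
    proof -
      have "(1 - m / (m + 1)) * (- 1) + (m / (m + 1)) * (1 / m) = 0"
        using m by (simp add: field_simps)
      then show ?thesis
        by (metis scaleR_left_distrib scaleR_scaleR scaleR_zero_left)
    qed
    moreover have "0 \<le> m / (m + 1)" "m / (m + 1) \<le> 1"
      using m by auto
    ultimately show "0 \<in> closed_segment ((- 1) *\<^sub>R u) ((1 / m) *\<^sub>R u)"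
      unfolding in_segment by blast
    show "norm ((- 1) *\<^sub>R u) / norm ((1 / m) *\<^sub>R u) = real (sylvester (CARD('n) + 1)) - 2"
      using \<open>u \<noteq> 0\<close> m by (simp add: m_def)
  qed
qed

text \<open>The ratio in a direction is at most the one at a generating point minimising a linear form
  that supports the polytope at \<open>b\<close>.\<close>

lemma asymmetry_ratio_le_at_vertex:
  fixes S :: "'a::euclidean_space set"
  assumes "finite S" and int0: "0 \<in> interior (convex hull S)"
    and a: "a \<in> frontier (convex hull S)" and b: "b \<in> frontier (convex hull S)"
    and seg: "0 \<in> closed_segment a b"
  obtains v where "v \<in> S" "v \<noteq> 0"
    "\<And>t. 0 < t \<Longrightarrow> - (t *\<^sub>R v) \<in> convex hull S \<Longrightarrow> norm a / norm b \<le> 1 / t"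
proof -
  define P where "P = convex hull S"
  have P: "convex P" "closed P"
    using \<open>finite S\<close> by (auto simp: P_def finite_imp_compact compact_convex_hull compact_imp_closed)
  have ab: "a \<in> P" "b \<in> P" "b \<notin> interior P" "b \<noteq> 0"
    using a b int0 P by (auto simp: P_def frontier_def)
  have rel: "rel_interior P = interior P"
    using int0 by (intro rel_interior_nonempty_interior) (auto simp: P_def)
  obtain h' where h': "\<And>y. y \<in> closure P \<Longrightarrow> h' \<bullet> b \<le> h' \<bullet> y"
    "\<And>y. y \<in> rel_interior P \<Longrightarrow> h' \<bullet> b < h' \<bullet> y"
    using supporting_hyperplane_relative_frontier[of P b] P ab rel
    by (metis closure_closed)
  define c where "c = - (h' \<bullet> b)"
  have "0 < c"
    using h'(2)[of 0] int0 rel by (simp add: c_def P_def)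
  define r where "r = norm a / norm b"
  have "a \<noteq> 0"
    using a int0 by (auto simp: frontier_def)
  obtain k where k: "0 \<le> k" "k \<le> 1" "0 = (1 - k) *\<^sub>R a + k *\<^sub>R b"
    using seg by (auto simp: in_segment)
  have "k \<noteq> 1"
    using k(3) ab(4) by auto
  then have "a = - ((k / (1 - k)) *\<^sub>R b)"
  proof -
    have "(1 - k) *\<^sub>R a = - (k *\<^sub>R b)"
      using k(3) by (simp add: eq_neg_iff_add_eq_0)
    then have "(1 / (1 - k)) *\<^sub>R ((1 - k) *\<^sub>R a) = (1 / (1 - k)) *\<^sub>R (- (k *\<^sub>R b))"
      by simp
    then show ?thesis
      using \<open>k \<noteq> 1\<close> by simp
  qed
  moreover from this have "r = k / (1 - k)"
    using k(1,2) ab(4) by (simp add: r_def)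
  ultimately have a_eq: "a = - (r *\<^sub>R b)"
    by simp
  have "0 < r"
    using \<open>a \<noteq> 0\<close> ab(4) by (simp add: r_def)
  obtain v where v: "v \<in> S" "h' \<bullet> a \<le> h' \<bullet> v"
  proof (rule ccontr)
    assume "\<not> thesis"
    then have "S \<subseteq> {x. h' \<bullet> x < h' \<bullet> a}"
      using that by force
    then have "P \<subseteq> {x. h' \<bullet> x < h' \<bullet> a}"
      unfolding P_def by (intro hull_minimal convex_halfspace_lt)
    then show False
      using ab(1) by auto
  qed
  \<comment> \<open>The minimum of \<open>h'\<close> on \<open>P\<close> is \<open>- c\<close>,
    attained at \<open>b\<close>, and \<open>h' \<bullet> a = r * c\<close>. A point
    \<open>- (t *\<^sub>R v)\<close> of \<open>P\<close> then satisfies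
    \<open>t * r * c \<le> c\<close>.\<close>
  then have hv: "r * c \<le> h' \<bullet> v"
    by (simp add: a_eq c_def)
  show thesis
  proof (rule that[OF v(1)])
    show "v \<noteq> 0"
      using hv \<open>0 < r\<close> \<open>0 < c\<close> by (auto simp: mult_le_0_iff)
    fix t :: real assume t: "0 < t" "- (t *\<^sub>R v) \<in> convex hull S"
    then have "h' \<bullet> b \<le> h' \<bullet> (- (t *\<^sub>R v))"
      using P by (intro h') (simp add: P_def)
    then have "t * (h' \<bullet> v) \<le> c"
      by (simp add: c_def)
    moreover have "t * (r * c) \<le> t * (h' \<bullet> v)"
      using t hv by simp
    ultimately have "(t * r) * c \<le> 1 * c"
      by (simp add: mult.assoc)
    then have "t * r \<le> 1"
      using \<open>0 < c\<close> mult_le_cancel_right_pos by blast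
    then show "norm a / norm b \<le> 1 / t"
      using t by (simp add: field_simps flip: r_def)
  qed
qed

theorem mainTheorem7:
  fixes P :: "(real^'n) set" and idx :: "'n \<Rightarrow> nat"
  assumes "bij_betw idx UNIV {1..CARD('n)}"
    and "lattice_polytope P"
    and "aff_dim P = int CARD('n)"
    and "interior P \<inter> int_points = {0}"
  shows "coeff_asym P 0 \<le> real (sylvester (CARD('n) + 1)) - 2
    \<and> (coeff_asym P 0 = real (sylvester (CARD('n) + 1)) - 2 \<longleftrightarrow> unimod_equiv P (T_simplex idx))"
proof -
  obtain S where S: "finite S" "S \<subseteq> int_points" "P = convex hull S"
    using assms(2) by (auto simp: lattice_polytope_def)
  have int0: "0 \<in> interior P"
    using assms(4) by auto
  have "bounded P" "closed P"
    unfolding S(3) using S(1)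
    by (auto simp: finite_imp_compact compact_convex_hull compact_imp_closed compact_imp_bounded)
  define m where "m = real (sylvester (CARD('n) + 1)) - 2"
  define R where "R = {norm a / norm b | a b. a \<in> frontier P \<and> b \<in> frontier P \<and> 0 \<in> closed_segment a b}"
  have ca: "coeff_asym P 0 = Sup R"
    by (simp add: coeff_asym_def R_def)
  \<comment> \<open>The ray from 0 through \<open>- v\<close> leaves \<open>P\<close> at the scale
    that is named \<open>\<tau> v\<close> below.\<close>
  have "\<exists>t>0. - (t *\<^sub>R v) \<in> frontier P" if "v \<noteq> 0" for v
    using ray_to_frontier[OF \<open>bounded P\<close> int0, of "- v"] that
    by (metis add.left_neutral neg_equal_0_iff_equal scaleR_minus_right)
  then obtain \<tau> where \<tau>: "\<And>v. v \<noteq> 0 \<Longrightarrow> 0 < \<tau> v" "\<And>v. v \<noteq> 0 \<Longrightarrow> - (\<tau> v *\<^sub>R v) \<in> frontier P"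
    by metis
  have \<tau>P: "- (\<tau> v *\<^sub>R v) \<in> P" if "v \<noteq> 0" for v
    using \<tau>(2)[OF that] frontier_subset_closed[OF \<open>closed P\<close>] by blast
  note bound = simplex_bound[OF assms(1) S(1,2) assms(4)[unfolded S(3)] _ \<tau>(1) \<tau>(2)[unfolded S(3)],
      folded S(3) m_def]
  have dominated: "\<exists>v\<in>S - {0}. x \<le> 1 / \<tau> v" if "x \<in> R" for x
  proof -
    obtain a b where ab: "x = norm a / norm b" "a \<in> frontier P" "b \<in> frontier P" "0 \<in> closed_segment a b"
      using \<open>x \<in> R\<close> by (auto simp: R_def)
    obtain v where "v \<in> S" "v \<noteq> 0"
      "\<And>t. 0 < t \<Longrightarrow> - (t *\<^sub>R v) \<in> P \<Longrightarrow> norm a / norm b \<le> 1 / t"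
      using asymmetry_ratio_le_at_vertex[of S a b] S(1,3) int0 ab by metis
    then show ?thesis
      using \<tau>(1) \<tau>P ab(1) by blast
  qed
  have le_m: "x \<le> m" if "x \<in> R" for x
    using dominated[OF that] bound(1) by force
  \<comment> \<open>Bounding \<open>Sup R\<close> through its elements requires a chord through 0;
    two opposite rays supply one.\<close>
  have "R \<noteq> {}"
  proof -
    obtain e :: "real^'n" where "e \<noteq> 0"
      using axis_eq_0_iff[of undefined "1::real"] by (metis zero_neq_one)
    define a b where "a = - (\<tau> e *\<^sub>R e)" and "b = - (\<tau> (- e) *\<^sub>R (- e))"
    have "0 < \<tau> e" "0 < \<tau> (- e)"
      using \<tau>(1) \<open>e \<noteq> 0\<close> by auto
    moreover have "a - b = - ((\<tau> e + \<tau> (- e)) *\<^sub>R e)"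
      by (simp add: a_def b_def scaleR_left_distrib)
    ultimately have "between (a, b) 0"
      unfolding between by (simp add: dist_norm) (simp add: a_def b_def distrib_right)
    then have "0 \<in> closed_segment a b"
      by (simp add: between_mem_segment)
    moreover have "a \<in> frontier P" "b \<in> frontier P"
      unfolding a_def b_def using \<open>e \<noteq> 0\<close> by (intro \<tau>(2); simp)+
    ultimately have "norm a / norm b \<in> R"
      unfolding R_def by blast
    then show ?thesis by auto
  qed
  then have "coeff_asym P 0 \<le> m"
    unfolding ca using le_m by (rule cSup_least)
  moreover have "unimod_equiv P (T_simplex idx)" if eq: "coeff_asym P 0 = m"
  proof -
    \<comment> \<open>Every ratio is dominated by one of the finitely many values
      \<open>1 / \<tau> v\<close>, so some vertex reaches \<open>m\<close> without the supremum
      itself having to be attained in \<open>R\<close>.\<close>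
    define V where "V = (\<lambda>v. 1 / \<tau> v) ` (S - {0})"
    have V: "finite V" "V \<noteq> {}"
      using S(1) \<open>R \<noteq> {}\<close> dominated by (auto simp: V_def)
    have "Sup R \<le> Max V"
    proof (rule cSup_least[OF \<open>R \<noteq> {}\<close>])
      fix x assume "x \<in> R"
      then obtain v where "v \<in> S - {0}" "x \<le> 1 / \<tau> v"
        using dominated by blast
      then show "x \<le> Max V"
        using V by (subst Max_ge_iff) (auto simp: V_def)
    qed
    moreover have "Max V \<in> V"
      using V by (rule Max_in)
    ultimately have "\<exists>v\<in>S - {0}. m \<le> 1 / \<tau> v"
      using eq ca unfolding V_def by (metis (no_types, lifting) imageE)
    then show ?thesis
      using bound(2) by blast
  qed
  moreover have "m \<le> coeff_asym P 0" if equiv: "unimod_equiv P (T_simplex idx)"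
  proof -
    obtain a b where "a \<in> frontier P" "b \<in> frontier P" "0 \<in> closed_segment a b" "norm a / norm b = m"
      unfolding m_def by (rule T_simplex_attains_asymmetry[OF assms(1,4) equiv]) blast
    then have "m \<in> R"
      by (auto simp: R_def)
    moreover have "bdd_above R"
      using le_m by (rule bdd_aboveI)
    ultimately show ?thesis
      unfolding ca by (rule cSup_upper)
  qed
  ultimately show ?thesis
    unfolding m_def by force
qed

end
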